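(* Let $E$ be a complex Banach lattice and let $A$ be a closed, densely defined real operator on $E$. Assume that $\lambda_0\in\sigma(A)\cap\mathbb{R}$ is a pole of $\mathcal{R}(\cdot,A)$ and suppose that $\mathcal{R}(\cdot,A)$ is uniformly eventually strongly positive with respect to $u$ at $\lambda_0$, where $u$ is a quasi-interior point of $E_+$. Then for all sufficiently small $r>0$ there exists $\varepsilon>0$ such that the following properties hold for every positive operator $B\in\mathcal{L}(E)$ of norm $\|B\|<\varepsilon$: (a) The operator $A+B$ has a unique spectral value $\lambda_B$ in $B(\lambda_0,r)$. (b) The spectral value $\lambda_B$ is a real number, a pole of the resolvent $\mathcal{R}(\cdot,A+B)$ and an algebraically simple eigenvalue of $A+B$. (c) The resolvent $\mathcal{R}(\cdot,A+B)$ is uniformly eventually strongly positive with respect to $u$ at $\lambda_B$.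
   Context: A complex Banach lattice $E$ is the complexification of a real Banach lattice $E_{\mathbb{R}}$; $E_+$ is its positive cone, $f\ge 0$ means $f\in E_+$, and $f>0$ means $f\ge 0$, $f\ne 0$. $\mathcal{L}(E)$ is the space of bounded linear operators on $E$; $T\in\mathcal{L}(E)$ is positive if $TE_+\subseteq E_+$. A linear operator $A\colon E\supseteq D(A)\to E$ is real if $D(A)=E_{\mathbb{R}}\cap D(A)+i\,(E_{\mathbb{R}}\cap D(A))$ and $A$ maps $E_{\mathbb{R}}\cap D(A)$ into $E_{\mathbb{R}}$. $\mathcal{R}(\lambda,A)=(\lambda I-A)^{-1}$ for $\lambda\in\rho(A)$. $B(\lambda,r)=\{z\in\mathbb{C}:|z-\lambda|<r\}$ for $\lambda\in\mathbb{C}$, $r>0$. A pole of the resolvent of an operator is called an algebraically simple eigenvalue if the associated spectral projection has one-dimensional range. For $u\in E_+$ let $E_u=\{x\in E:\ |x|\le cu\text{ for some }c\ge 0\}$; $u\in E_+$ is a quasi-interior point of $E_+$ if $E_u$ is dense in $E$. Write $f\gg_u0$ if there is $\varepsilon>0$ with $f\ge\varepsilon u$. The resolvent of $A$ is uniformly eventually strongly positive with respect to $u$ at a real spectral value $\lambda_0$ of $A$ if there exists a real number $\lambda_1>\lambda_0$ such that $(\lambda_0,\lambda_1]\subseteq\rho(A)$ and $\mathcal{R}(\lambda,A)f\gg_u 0$ for all $\lambda\in(\lambda_0,\lambda_1]$ and all $0<f\in E$. *)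

theory Defs
  imports
    "HOL-Analysis.Analysis"
    "HOL-Library.Lattice_Algebras"
    "HOL-Complex_Analysis.Complex_Analysis"
begin

section \<open>Real Banach lattices\<close>

class banach_lattice = banach + ordered_real_vector + lattice_ab_group_add_abs +
  assumes lattice_norm: "\<bar>x\<bar> \<le> \<bar>y\<bar> \<Longrightarrow> norm x \<le> norm y"

instance real :: banach_lattice
  by standard (auto simp: sup_real_def)

lemma banach_lattice_norm_abs [simp]: "norm \<bar>x\<bar> = norm (x :: 'a::banach_lattice)"
  by (intro antisym lattice_norm) auto

lemma banach_lattice_norm_mono:
  fixes x y :: "'a::banach_lattice"
  assumes "0 \<le> x" "x \<le> y" shows "norm x \<le> norm y"
  using assms by (intro lattice_norm) simp

lemma banach_lattice_limit_nonneg: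
  fixes f :: "nat \<Rightarrow> 'a::banach_lattice"
  assumes lim: "f \<longlonglongrightarrow> l" and nonneg: "\<And>n. 0 \<le> f n"
  shows "0 \<le> l"
proof -
  have le: "norm (nprt l) \<le> norm (l - f n)" for n
  proof -
    have "- \<bar>l - f n\<bar> \<le> l - f n" by (metis abs_ge_minus_self minus_le_iff)
    also have "\<dots> \<le> l" using nonneg by simp
    finally have "- \<bar>l - f n\<bar> \<le> nprt l" by (simp add: nprt_def)
    then have "- nprt l \<le> \<bar>l - f n\<bar>" by (simp add: minus_le_iff)
    then have "norm (- nprt l) \<le> norm \<bar>l - f n\<bar>"
      by (intro banach_lattice_norm_mono) auto
    then show ?thesis by simp
  qed
  have "(\<lambda>n. norm (l - f n)) \<longlonglongrightarrow> norm (l - l)"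
    by (intro tendsto_intros lim)
  then have "norm (nprt l) \<le> 0"
    by (intro LIMSEQ_le_const[where X = "\<lambda>n. norm (l - f n)"]) (auto simp: le)
  then show ?thesis by (simp add: zero_le_iff_zero_nprt)
qed

lemma banach_lattice_limit_mono:
  fixes f g :: "nat \<Rightarrow> 'a::banach_lattice"
  assumes "f \<longlonglongrightarrow> l" "g \<longlonglongrightarrow> m" "\<And>n. f n \<le> g n"
  shows "l \<le> m"
  using banach_lattice_limit_nonneg[of "\<lambda>n. g n - f n" "m - l"] assms
  by (auto intro: tendsto_diff)

section \<open>Complex normed spaces\<close>

class complex_normed_vector = real_normed_vector +
  fixes scaleC :: "complex \<Rightarrow> 'a \<Rightarrow> 'a" (infixr "*\<^sub>C" 75)
  assumes scaleC_add_right: "c *\<^sub>C (x + y) = c *\<^sub>C x + c *\<^sub>C y"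
    and scaleC_add_left: "(c + d) *\<^sub>C x = c *\<^sub>C x + d *\<^sub>C x"
    and scaleC_scaleC: "c *\<^sub>C d *\<^sub>C x = (c * d) *\<^sub>C x"
    and scaleC_of_real: "complex_of_real r *\<^sub>C x = r *\<^sub>R x"
    and norm_scaleC: "norm (c *\<^sub>C x) = cmod c * norm x"

lemma bounded_linear_scaleC:
  "bounded_linear (\<lambda>x :: 'a::complex_normed_vector. c *\<^sub>C x)"
proof (rule bounded_linear_intro[where K = "cmod c"])
  fix x y :: 'a and r :: real
  show "c *\<^sub>C (x + y) = c *\<^sub>C x + c *\<^sub>C y" by (rule scaleC_add_right)
  show "c *\<^sub>C (r *\<^sub>R x) = r *\<^sub>R (c *\<^sub>C x)"
    by (simp add: scaleC_scaleC mult.commute flip: scaleC_of_real)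
  show "norm (c *\<^sub>C x) \<le> norm x * cmod c" by (simp add: norm_scaleC)
qed

instantiation blinfun :: (real_normed_vector, complex_normed_vector) complex_normed_vector
begin

lift_definition scaleC_blinfun ::
    "complex \<Rightarrow> ('a::real_normed_vector) \<Rightarrow>\<^sub>L ('b::complex_normed_vector) \<Rightarrow> 'a \<Rightarrow>\<^sub>L 'b"
  is "\<lambda>c T x. c *\<^sub>C T x"
  by (rule bounded_linear_compose[OF bounded_linear_scaleC])

instance
proof
  fix c d :: complex and r :: real and S T :: "'a \<Rightarrow>\<^sub>L 'b"
  show "c *\<^sub>C (S + T) = c *\<^sub>C S + c *\<^sub>C T"
    by transfer (simp add: scaleC_add_right)
  show "(c + d) *\<^sub>C T = c *\<^sub>C T + d *\<^sub>C T"
    by transfer (simp add: scaleC_add_left)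
  show "c *\<^sub>C d *\<^sub>C T = (c * d) *\<^sub>C T"
    by transfer (simp add: scaleC_scaleC)
  show "complex_of_real r *\<^sub>C T = r *\<^sub>R T"
    by transfer (simp add: scaleC_of_real)
  have le: "norm (c *\<^sub>C T) \<le> cmod c * norm T" for c and T :: "'a \<Rightarrow>\<^sub>L 'b"
  proof (rule norm_blinfun_bound)
    fix x
    show "norm ((c *\<^sub>C T) x) \<le> cmod c * norm T * norm x"
      using norm_blinfun[of T x]
      by (simp add: scaleC_blinfun.rep_eq norm_scaleC mult.assoc mult_left_mono)
  qed simp
  show "norm (c *\<^sub>C T) = cmod c * norm T"
  proof (cases "c = 0")
    case True
    then show ?thesis using le[of c T] by simp
  next
    case False
    have one: "1 *\<^sub>C x = x" for x :: 'b
      using scaleC_of_real[of 1 x] by simp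
    have "inverse c *\<^sub>C c *\<^sub>C T = T"
      using False by transfer (simp add: scaleC_scaleC one)
    then have "norm T \<le> inverse (cmod c) * norm (c *\<^sub>C T)"
      using le[of "inverse c" "c *\<^sub>C T"] by (simp add: norm_inverse)
    then have "cmod c * norm T \<le> norm (c *\<^sub>C T)"
      using False by (simp add: field_simps)
    then show ?thesis using le[of c T] by simp
  qed
qed

end

section \<open>The complexification of a real Banach lattice\<close>

datatype 'a complexification = Cx (re: 'a) (im: 'a)

lemma complexification_eq_iff: "z = w \<longleftrightarrow> re z = re w \<and> im z = im w"
  by (cases z; cases w) simp

text \<open>The supremum over all \<open>t\<close> of the real parts of \<open>exp (- \<i> t) z\<close>. It exists in every
  Banach lattice, see \<open>modulus_exists\<close> below.\<close>

definition modulus :: "('a::banach_lattice) complexification \<Rightarrow> 'a" where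
  "modulus z = (THE s. (\<forall>t. cos t *\<^sub>R re z + sin t *\<^sub>R im z \<le> s) \<and>
                       (\<forall>s'. (\<forall>t. cos t *\<^sub>R re z + sin t *\<^sub>R im z \<le> s') \<longrightarrow> s \<le> s'))"

lemma scaleR_le_abs:
  fixes x :: "'a::banach_lattice"
  assumes "\<bar>r\<bar> \<le> e" shows "r *\<^sub>R x \<le> e *\<^sub>R \<bar>x\<bar>"
proof -
  have 1: "r *\<^sub>R x \<le> \<bar>r\<bar> *\<^sub>R \<bar>x\<bar>"
  proof (cases "r \<ge> 0")
    case True
    then show ?thesis by (auto intro!: scaleR_left_mono abs_ge_self)
  next
    case False
    have "(- r) *\<^sub>R (- x) \<le> (- r) *\<^sub>R \<bar>x\<bar>"
      using False by (intro scaleR_left_mono) (auto simp: abs_ge_minus_self)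
    then show ?thesis using False by simp
  qed
  also have "\<dots> \<le> e *\<^sub>R \<bar>x\<bar>" using assms by (intro scaleR_right_mono) auto
  finally show ?thesis .
qed

lemma modulus_exists:
  fixes x y :: "'a::banach_lattice"
  shows "\<exists>s. (\<forall>t. cos t *\<^sub>R x + sin t *\<^sub>R y \<le> s) \<and>
             (\<forall>s'. (\<forall>t. cos t *\<^sub>R x + sin t *\<^sub>R y \<le> s') \<longrightarrow> s \<le> s')"
proof -
  define g where "g = (\<lambda>c. Re c *\<^sub>R x + Im c *\<^sub>R y)"
  define w where "w = \<bar>x\<bar> + \<bar>y\<bar>"
  have w0: "0 \<le> w" by (simp add: w_def)
  have lip: "g c \<le> g d + e *\<^sub>R w" if "dist c d \<le> e" for c d e
  proof -
    have "\<bar>Re c - Re d\<bar> \<le> e" "\<bar>Im c - Im d\<bar> \<le> e"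
      using that abs_Re_le_cmod[of "c - d"] abs_Im_le_cmod[of "c - d"]
      by (simp_all add: dist_norm)
    then have "(Re c - Re d) *\<^sub>R x + (Im c - Im d) *\<^sub>R y \<le> e *\<^sub>R \<bar>x\<bar> + e *\<^sub>R \<bar>y\<bar>"
      by (intro add_mono scaleR_le_abs)
    then have "g c - g d \<le> e *\<^sub>R w"
      by (simp add: g_def w_def algebra_simps)
    then show ?thesis by (simp add: algebra_simps)
  qed
  let ?S = "sphere 0 1 :: complex set"
  have "\<forall>\<epsilon>>0. \<exists>k. finite k \<and> k \<subseteq> ?S \<and> ?S \<subseteq> (\<Union>c\<in>k. ball c \<epsilon>)"
    by (intro seq_compact_imp_totally_bounded compact_imp_seq_compact compact_sphere)
  then have "\<forall>n. \<exists>k. finite k \<and> k \<subseteq> ?S \<and> ?S \<subseteq> (\<Union>c\<in>k. ball c ((1/2)^n))"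
    by simp
  then obtain K where K: "\<And>n. finite (K n)" "\<And>n. K n \<subseteq> ?S"
      "\<And>n. ?S \<subseteq> (\<Union>c\<in>K n. ball c ((1/2::real)^n))"
    by metis
  define G where "G n = (\<Union>k\<le>n. g ` K k)" for n
  have K_ne: "K n \<noteq> {}" for n
    using K(3)[of n] by (metis UN_empty all_not_in_conv dist_0_norm mem_sphere norm_one subset_empty)
  have G: "finite (G n)" "G n \<noteq> {}" for n
    using K(1) K_ne by (auto simp: G_def)
  define s where "s n = Sup_fin (G n)" for n
  have s_upper: "a \<le> s n" if "a \<in> G n" for a n
    unfolding s_def using G that by (intro Sup_fin.coboundedI) auto
  have s_least: "s n \<le> b" if "\<And>c. c \<in> ?S \<Longrightarrow> g c \<le> b" for n b
    unfolding s_def using G that K(2) by (intro Sup_fin.boundedI) (auto simp: G_def subset_iff)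
  have g_le: "g c \<le> s n + ((1/2)^n) *\<^sub>R w" if c: "c \<in> ?S" for c n
  proof -
    obtain d where d: "d \<in> K n" "dist d c < (1/2)^n"
      using subsetD[OF K(3)[of n] c] by auto
    have "g c \<le> g d + ((1/2)^n) *\<^sub>R w"
      using d(2) by (intro lip) (simp add: dist_commute)
    moreover have "g d \<le> s n" using d(1) by (intro s_upper) (auto simp: G_def)
    ultimately show ?thesis by (meson add_right_mono order_trans)
  qed
  have mono: "s n \<le> s m" if "n \<le> m" for n m
  proof -
    have "G n \<subseteq> G m" using that unfolding G_def by (intro UN_mono) auto
    then show ?thesis unfolding s_def by (intro Sup_fin.subset_imp G)
  qed
  have norm_le: "norm (s m - s n) \<le> (1/2)^n * norm w" if "n \<le> m" for n m
  proof -
    have "s m \<le> s n + ((1/2)^n) *\<^sub>R w" using g_le by (rule s_least)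
    then have "norm (s m - s n) \<le> norm (((1/2)^n) *\<^sub>R w)"
      using mono[OF that] by (intro banach_lattice_norm_mono) (auto simp: algebra_simps)
    then show ?thesis by simp
  qed
  have lim0: "(\<lambda>n. (1/2)^n * norm w) \<longlonglongrightarrow> 0"
    by (intro tendsto_mult_left_zero LIMSEQ_power_zero) simp
  have "Cauchy s"
  proof (rule CauchyI')
    fix e :: real assume "0 < e"
    then obtain N where N: "(1/2)^N * norm w < e"
      using order_tendstoD(2)[OF lim0, of e] by (auto simp: eventually_sequentially)
    have "norm (s m - s n) < e" if "N \<le> m" "m < n" for m n
    proof -
      have "norm (s n - s m) \<le> (1/2)^m * norm w" using that by (intro norm_le) simp
      also have "\<dots> \<le> (1/2)^N * norm w"
        using that by (intro mult_right_mono power_decreasing) auto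
      finally show ?thesis using N by (simp add: norm_minus_commute)
    qed
    then show "\<exists>M. \<forall>m\<ge>M. \<forall>n>m. dist (s m) (s n) < e"
      by (auto simp: dist_norm)
  qed
  then obtain l where l: "s \<longlonglongrightarrow> l"
    using Cauchy_convergent convergent_def by blast
  have l_least: "l \<le> b" if "\<And>c. c \<in> ?S \<Longrightarrow> g c \<le> b" for b
    by (rule banach_lattice_limit_mono[OF l tendsto_const]) (rule s_least[OF that])
  have l_upper: "g c \<le> l" if "c \<in> ?S" for c
  proof (rule banach_lattice_limit_mono[OF tendsto_const])
    have "(\<lambda>n. s n + ((1/2)^n) *\<^sub>R w) \<longlonglongrightarrow> l + 0 *\<^sub>R w"
      by (intro tendsto_intros l LIMSEQ_power_zero) simp
    then show "(\<lambda>n. s n + ((1/2)^n) *\<^sub>R w) \<longlonglongrightarrow> l" by simp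
  qed (rule g_le[OF that])
  have "g (cis t) \<le> l" for t by (rule l_upper) simp
  moreover have "l \<le> b" if "\<forall>t. g (cis t) \<le> b" for b
  proof (rule l_least)
    fix c :: complex assume "c \<in> ?S"
    then have "c = cis (Arg c)" using rcis_cmod_Arg[of c] by (simp add: rcis_def)
    then show "g c \<le> b" using that by metis
  qed
  ultimately show ?thesis by (auto simp: g_def intro!: exI[of _ l])
qed

lemma modulus_upper: "cos t *\<^sub>R re z + sin t *\<^sub>R im z \<le> modulus z" (is ?P)
  and modulus_least: "(\<And>t. cos t *\<^sub>R re z + sin t *\<^sub>R im z \<le> b) \<Longrightarrow> modulus z \<le> b" (is "PROP ?Q")
proof -
  let ?U = "\<lambda>s. (\<forall>t. cos t *\<^sub>R re z + sin t *\<^sub>R im z \<le> s) \<and>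
             (\<forall>s'. (\<forall>t. cos t *\<^sub>R re z + sin t *\<^sub>R im z \<le> s') \<longrightarrow> s \<le> s')"
  have "\<exists>!s. ?U s" using modulus_exists[of "re z" "im z"] by (auto intro: antisym)
  from theI'[OF this] have "?U (modulus z)" unfolding modulus_def .
  then show ?P "PROP ?Q" by blast+
qed

lemma modulus_nonneg: "0 \<le> modulus z"
  using add_mono[OF modulus_upper[of 0 z] modulus_upper[of pi z]] by simp

lemma abs_re_le_modulus: "\<bar>re z\<bar> \<le> modulus z" and abs_im_le_modulus: "\<bar>im z\<bar> \<le> modulus z"
  using modulus_upper[of 0 z] modulus_upper[of pi z]
    modulus_upper[of "pi/2" z] modulus_upper[of "- (pi/2)" z]
  by (auto intro!: abs_leI)

lemma modulus_le: "modulus z \<le> \<bar>re z\<bar> + \<bar>im z\<bar>"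
proof (rule modulus_least)
  fix t
  show "cos t *\<^sub>R re z + sin t *\<^sub>R im z \<le> \<bar>re z\<bar> + \<bar>im z\<bar>"
    using add_mono[OF scaleR_le_abs[of "cos t" 1 "re z"] scaleR_le_abs[of "sin t" 1 "im z"]]
    by simp
qed

lemma modulus_of_real_part: "modulus (Cx x 0) = \<bar>x\<bar>"
  using abs_re_le_modulus[of "Cx x 0"] modulus_le[of "Cx x 0"] by simp

instantiation complexification :: (banach_lattice) ordered_real_vector
begin

definition "0 = Cx 0 0"
definition "z + w = Cx (re z + re w) (im z + im w)"
definition "- z = Cx (- re z) (- im z)"
definition "z - w = Cx (re z - re w) (im z - im w)"
definition "r *\<^sub>R z = Cx (r *\<^sub>R re z) (r *\<^sub>R im z)"

text \<open>\<open>z \<le> w\<close> means that \<open>w - z\<close> lies in the positive cone of the real Banach lattice.\<close>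

definition "z \<le> w \<longleftrightarrow> re z \<le> re w \<and> im z = im w"
definition "z < w \<longleftrightarrow> z \<le> w \<and> z \<noteq> (w :: 'a complexification)"

instance
  by standard
    (auto simp: complexification_eq_iff zero_complexification_def plus_complexification_def
      uminus_complexification_def minus_complexification_def scaleR_complexification_def
      less_eq_complexification_def less_complexification_def algebra_simps
      intro: scaleR_left_mono scaleR_right_mono)

end

lemmas complexification_ops =
  zero_complexification_def plus_complexification_def uminus_complexification_def
  minus_complexification_def scaleR_complexification_def

lemma complexification_sel [simp]:
  fixes z w :: "('a::banach_lattice) complexification"
  shows "re 0 = (0 :: 'a)" "im 0 = (0 :: 'a)"
    "re (z + w) = re z + re w" "im (z + w) = im z + im w"
    "re (- z) = - re z" "im (- z) = - im z"
    "re (z - w) = re z - re w" "im (z - w) = im z - im w"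
    "re (r *\<^sub>R z) = r *\<^sub>R re z" "im (r *\<^sub>R z) = r *\<^sub>R im z"
  by (simp_all add: complexification_ops)

lemma modulus_triangle: "modulus (z + w) \<le> modulus z + modulus w"
proof (rule modulus_least)
  fix t
  show "cos t *\<^sub>R re (z + w) + sin t *\<^sub>R im (z + w) \<le> modulus z + modulus w"
    using add_mono[OF modulus_upper[of t z] modulus_upper[of t w]] by (simp add: algebra_simps)
qed

lemma modulus_mult_le:
  "modulus (Cx (Re c *\<^sub>R re z - Im c *\<^sub>R im z) (Re c *\<^sub>R im z + Im c *\<^sub>R re z))
     \<le> cmod c *\<^sub>R modulus z"
proof (rule modulus_least)
  fix t
  have Re: "Re c = cmod c * cos (Arg c)" and Im: "Im c = cmod c * sin (Arg c)"
    by (metis Re_rcis rcis_cmod_Arg, metis Im_rcis rcis_cmod_Arg)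
  have "cmod c *\<^sub>R (cos (t - Arg c) *\<^sub>R re z + sin (t - Arg c) *\<^sub>R im z) \<le> cmod c *\<^sub>R modulus z"
    by (intro scaleR_left_mono modulus_upper) simp
  moreover have "cmod c *\<^sub>R (cos (t - Arg c) *\<^sub>R re z + sin (t - Arg c) *\<^sub>R im z) =
      (cos t * Re c + sin t * Im c) *\<^sub>R re z + (sin t * Re c - cos t * Im c) *\<^sub>R im z"
    unfolding Re Im by (simp add: cos_diff sin_diff algebra_simps)
  moreover have "(cos t * Re c + sin t * Im c) *\<^sub>R x + (sin t * Re c - cos t * Im c) *\<^sub>R y =
      cos t *\<^sub>R (Re c *\<^sub>R x - Im c *\<^sub>R y) + sin t *\<^sub>R (Re c *\<^sub>R y + Im c *\<^sub>R x)"
    for x y :: 'a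
    by (simp add: algebra_simps)
  ultimately show "cos t *\<^sub>R re (Cx (Re c *\<^sub>R re z - Im c *\<^sub>R im z) (Re c *\<^sub>R im z + Im c *\<^sub>R re z)) +
      sin t *\<^sub>R im (Cx (Re c *\<^sub>R re z - Im c *\<^sub>R im z) (Re c *\<^sub>R im z + Im c *\<^sub>R re z))
      \<le> cmod c *\<^sub>R modulus z"
    by simp
qed

instantiation complexification :: (banach_lattice) complex_normed_vector
begin

definition "norm z = norm (modulus z)"
definition "dist z w = norm (z - w :: 'a complexification)"
definition "sgn z = z /\<^sub>R norm (z :: 'a complexification)"
definition "(uniformity :: ('a complexification \<times> 'a complexification) filter) =
  (INF e\<in>{0 <..}. principal {(x, y). dist x y < e})"
definition "open (U :: 'a complexification set) \<longleftrightarrow>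
  (\<forall>x\<in>U. eventually (\<lambda>(x', y). x' = x \<longrightarrow> y \<in> U) uniformity)"
definition "c *\<^sub>C z = Cx (Re c *\<^sub>R re z - Im c *\<^sub>R im z) (Re c *\<^sub>R im z + Im c *\<^sub>R re z)"

instance
proof
  fix c d :: complex and r :: real and z w :: "'a complexification"
  show "c *\<^sub>C (z + w) = c *\<^sub>C z + c *\<^sub>C w"
    and "(c + d) *\<^sub>C z = c *\<^sub>C z + d *\<^sub>C z"
    and "c *\<^sub>C d *\<^sub>C z = (c * d) *\<^sub>C z"
    and of_real: "complex_of_real r *\<^sub>C z = r *\<^sub>R z" for r z
    by (simp_all add: scaleC_complexification_def complexification_eq_iff algebra_simps)
  show norm_0: "norm z = 0 \<longleftrightarrow> z = 0" for z :: "'a complexification"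
  proof
    assume "norm z = 0"
    then have "\<bar>re z\<bar> \<le> 0" "\<bar>im z\<bar> \<le> 0"
      using abs_re_le_modulus[of z] abs_im_le_modulus[of z]
      by (simp_all add: norm_complexification_def)
    then show "z = 0" by (simp add: complexification_eq_iff)
  next
    assume "z = 0"
    then show "norm z = 0"
      by (simp add: norm_complexification_def zero_complexification_def modulus_of_real_part)
  qed
  show "norm (z + w) \<le> norm z + norm w"
    unfolding norm_complexification_def
    by (rule order_trans[OF banach_lattice_norm_mono[OF modulus_nonneg modulus_triangle]
          norm_triangle_ineq])
  have le: "norm (c *\<^sub>C z) \<le> cmod c * norm z" for c and z :: "'a complexification"
    using banach_lattice_norm_mono[OF modulus_nonneg modulus_mult_le[of c z]]
    by (simp add: norm_complexification_def scaleC_complexification_def)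
  show norm_scaleC: "norm (c *\<^sub>C z) = cmod c * norm z" for c and z :: "'a complexification"
  proof (cases "c = 0")
    case True
    then show ?thesis using of_real[of 0 z] norm_0[of 0] by simp
  next
    case False
    have "inverse c *\<^sub>C c *\<^sub>C z = (inverse c * c) *\<^sub>C z"
      by (simp add: scaleC_complexification_def complexification_eq_iff algebra_simps)
    then have "inverse c *\<^sub>C c *\<^sub>C z = z" using False of_real[of 1 z] by simp
    then have "norm z \<le> inverse (cmod c) * norm (c *\<^sub>C z)"
      using le[of "inverse c" "c *\<^sub>C z"] by (simp add: norm_inverse)
    then show ?thesis using False le[of c z] by (simp add: field_simps)
  qed
  show "norm (r *\<^sub>R z) = \<bar>r\<bar> * norm z"
    using norm_scaleC[of "complex_of_real r" z] by (simp add: of_real)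
qed (rule dist_complexification_def sgn_complexification_def uniformity_complexification_def
      open_complexification_def)+

end

instance complexification :: (banach_lattice) banach
proof
  fix X :: "nat \<Rightarrow> 'a complexification"
  assume X: "Cauchy X"
  have re_le: "norm (re z) \<le> norm z" and im_le: "norm (im z) \<le> norm z"
    for z :: "'a complexification"
    using banach_lattice_norm_mono[OF _ abs_re_le_modulus[of z]]
      banach_lattice_norm_mono[OF _ abs_im_le_modulus[of z]]
    by (simp_all add: norm_complexification_def)
  have le: "norm z \<le> norm (re z) + norm (im z)" for z :: "'a complexification"
    using order_trans[OF banach_lattice_norm_mono[OF modulus_nonneg modulus_le[of z]]
        norm_triangle_ineq]
    by (simp add: norm_complexification_def)
  have "Cauchy (\<lambda>n. re (X n))" "Cauchy (\<lambda>n. im (X n))"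
    unfolding Cauchy_def dist_norm
    using X[unfolded Cauchy_def dist_norm] re_le[of "X _ - X _"] im_le[of "X _ - X _"]
    by (simp_all, meson le_less_trans, meson le_less_trans)
  then obtain a b where a: "(\<lambda>n. re (X n)) \<longlonglongrightarrow> a" and b: "(\<lambda>n. im (X n)) \<longlonglongrightarrow> b"
    using Cauchy_convergent convergent_def by metis
  have "(\<lambda>n. norm (re (X n) - a) + norm (im (X n) - b)) \<longlonglongrightarrow> norm (a - a) + norm (b - b)"
    by (intro tendsto_intros a b)
  then have lim: "(\<lambda>n. norm (re (X n) - a) + norm (im (X n) - b)) \<longlonglongrightarrow> 0"
    by simp
  have bound: "norm (X n - Cx a b) \<le> norm (re (X n) - a) + norm (im (X n) - b)" for n
    using le[of "X n - Cx a b"] by simp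
  have "(\<lambda>n. X n - Cx a b) \<longlonglongrightarrow> 0"
    by (rule Lim_null_comparison[OF _ lim]) (simp add: bound)
  then have "X \<longlonglongrightarrow> Cx a b" by (rule LIM_zero_cancel)
  then show "convergent X" by (auto simp: convergent_def)
qed

instantiation complexification :: (banach_lattice) abs
begin

definition "\<bar>z\<bar> = Cx (modulus z) 0"

instance ..

end

definition real_space :: "('a::banach_lattice) complexification set" where
  "real_space = {z. im z = 0}"

section \<open>Unbounded operators\<close>

text \<open>An operator is given by its domain \<open>D\<close> together with a function \<open>A\<close>, whose values outside
  \<open>D\<close> are irrelevant. Thus \<open>A + B\<close>, for \<open>B\<close> bounded and everywhere defined, has the same
  domain \<open>D\<close> and the function \<open>\<lambda>x. A x + B x\<close>.\<close>

definition complex_linear_on ::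
    "('a::complex_normed_vector) set \<Rightarrow> ('a \<Rightarrow> 'b::complex_normed_vector) \<Rightarrow> bool" where
  "complex_linear_on D A \<longleftrightarrow>
     0 \<in> D \<and> (\<forall>x\<in>D. \<forall>y\<in>D. x + y \<in> D \<and> A (x + y) = A x + A y) \<and>
     (\<forall>c. \<forall>x\<in>D. c *\<^sub>C x \<in> D \<and> A (c *\<^sub>C x) = c *\<^sub>C A x)"

definition closed_operator ::
    "('a::complex_normed_vector) set \<Rightarrow> ('a \<Rightarrow> 'b::complex_normed_vector) \<Rightarrow> bool" where
  "closed_operator D A \<longleftrightarrow> closed {(x, A x) | x. x \<in> D}"

definition densely_defined :: "('a::complex_normed_vector) set \<Rightarrow> bool" where
  "densely_defined D \<longleftrightarrow> closure D = UNIV"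

definition resolvent_set ::
    "('a::complex_normed_vector) set \<Rightarrow> ('a \<Rightarrow> 'a) \<Rightarrow> complex set" where
  "resolvent_set D A =
     {z. bij_betw (\<lambda>x. z *\<^sub>C x - A x) D UNIV \<and>
         bounded_linear (the_inv_into D (\<lambda>x. z *\<^sub>C x - A x))}"

definition spectrum ::
    "('a::complex_normed_vector) set \<Rightarrow> ('a \<Rightarrow> 'a) \<Rightarrow> complex set" where
  "spectrum D A = - resolvent_set D A"

definition resolvent ::
    "('a::complex_normed_vector) set \<Rightarrow> ('a \<Rightarrow> 'a) \<Rightarrow> complex \<Rightarrow> 'a \<Rightarrow>\<^sub>L 'a" where
  "resolvent D A z = Blinfun (the_inv_into D (\<lambda>x. z *\<^sub>C x - A x))"

text \<open>Laurent expansion in operator norm around the isolated spectral value \<open>\<mu>\<close>; the pole has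
  order \<open>m\<close>.\<close>

definition pole_of_resolvent ::
    "('a::complex_normed_vector) set \<Rightarrow> ('a \<Rightarrow> 'a) \<Rightarrow> complex \<Rightarrow> bool" where
  "pole_of_resolvent D A \<mu> \<longleftrightarrow>
     (\<exists>m\<ge>1. \<exists>Q :: nat \<Rightarrow> 'a \<Rightarrow>\<^sub>L 'a. \<exists>\<rho>>0. Q 0 \<noteq> 0 \<and>
        (\<forall>z\<in>ball \<mu> \<rho> - {\<mu>}. z \<in> resolvent_set D A \<and>
           (\<lambda>n. (z - \<mu>) powi (int n - int m) *\<^sub>C Q n) sums resolvent D A z))"

text \<open>\<open>P\<close> is \<open>1 / (2 \<pi> \<i>)\<close> times the contour integral of the resolvent over a small positively
  oriented circle around \<open>\<mu>\<close> (the library's contour integral only covers complex-valued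
  functions).\<close>

definition is_spectral_projection ::
    "('a::complex_normed_vector) set \<Rightarrow> ('a \<Rightarrow> 'a) \<Rightarrow> complex \<Rightarrow> ('a \<Rightarrow>\<^sub>L 'a) \<Rightarrow> bool" where
  "is_spectral_projection D A \<mu> P \<longleftrightarrow>
     (\<exists>\<rho>>0. cball \<mu> \<rho> - {\<mu>} \<subseteq> resolvent_set D A \<and>
        ((\<lambda>t. vector_derivative (circlepath \<mu> \<rho>) (at t within {0..1}) *\<^sub>C
               resolvent D A (circlepath \<mu> \<rho> t))
         has_integral (2 * of_real pi * \<i>) *\<^sub>C P) {0..1})"

definition algebraically_simple_eigenvalue ::
    "('a::complex_normed_vector) set \<Rightarrow> ('a \<Rightarrow> 'a) \<Rightarrow> complex \<Rightarrow> bool" where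
  "algebraically_simple_eigenvalue D A \<mu> \<longleftrightarrow>
     pole_of_resolvent D A \<mu> \<and>
     (\<exists>P. is_spectral_projection D A \<mu> P \<and>
          (\<exists>v. v \<noteq> 0 \<and> range (blinfun_apply P) = {c *\<^sub>C v | c. True}))"

section \<open>Positivity\<close>

definition real_operator ::
    "('a::banach_lattice) complexification set \<Rightarrow>
      ('a complexification \<Rightarrow> 'a complexification) \<Rightarrow> bool" where
  "real_operator D A \<longleftrightarrow>
     D = {x + \<i> *\<^sub>C y | x y. x \<in> real_space \<inter> D \<and> y \<in> real_space \<inter> D} \<and>
     A ` (real_space \<inter> D) \<subseteq> real_space"

definition positive_operator ::
    "('a::banach_lattice) complexification \<Rightarrow>\<^sub>L 'a complexification \<Rightarrow> bool" where
  "positive_operator T \<longleftrightarrow> (\<forall>f\<ge>0. T f \<ge> 0)"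

definition principal_ideal ::
    "('a::banach_lattice) complexification \<Rightarrow> 'a complexification set" where
  "principal_ideal u = {x. \<exists>c::real. c \<ge> 0 \<and> \<bar>x\<bar> \<le> c *\<^sub>R u}"

definition quasi_interior_point :: "('a::banach_lattice) complexification \<Rightarrow> bool" where
  "quasi_interior_point u \<longleftrightarrow> u \<ge> 0 \<and> closure (principal_ideal u) = UNIV"

definition strongly_positive ::
    "('a::banach_lattice) complexification \<Rightarrow> 'a complexification \<Rightarrow> bool" where
  "strongly_positive u f \<longleftrightarrow> (\<exists>\<epsilon>::real. \<epsilon> > 0 \<and> f \<ge> \<epsilon> *\<^sub>R u)"

definition resolvent_unif_ev_strongly_positive ::
    "('a::banach_lattice) complexification set \<Rightarrow>
      ('a complexification \<Rightarrow> 'a complexification) \<Rightarrow> 'a complexification \<Rightarrow> real \<Rightarrow> bool" where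
  "resolvent_unif_ev_strongly_positive D A u \<mu> \<longleftrightarrow>
     complex_of_real \<mu> \<in> spectrum D A \<and>
     (\<exists>\<mu>\<^sub>1>\<mu>. \<forall>z\<in>{\<mu><..\<mu>\<^sub>1}. complex_of_real z \<in> resolvent_set D A \<and>
        (\<forall>f>0. strongly_positive u (resolvent D A (complex_of_real z) f)))"

end

theory Submission
  imports Defs
begin

text \<open>Strong positivity of the resolvent to the right of \<open>\<mu>\<^sub>0\<close> forces Perron--Frobenius behaviour at
  \<open>\<mu>\<^sub>0\<close>: the pole is simple and its spectral projection \<open>P\<close> has rank one (lemma \<open>dominant_pole\<close>).
  Indeed every positive eigenvector dominates a multiple of \<open>u\<close>, which excludes poles of higher
  order and excludes two disjoint positive eigenvectors.

  A simple pole of rank one is stable under small bounded perturbations \<open>B\<close> (lemma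
  \<open>simple_pole_perturbation\<close>). A pair consisting of the projection and the reduced resolvent \<open>S\<close> is
  characterised by a few algebraic equations (\<open>simple_pole_data\<close>), and such a pair determines the
  resolvent on the punctured disc of radius \<open>1 / norm S\<close> through a Neumann series. For \<open>A + B\<close> the
  pair is built explicitly by a Lyapunov--Schmidt reduction to a scalar fixed-point equation, which
  the contraction principle solves. The bound on the perturbed \<open>S\<close> is uniform in \<open>B\<close>, whence
  the perturbed spectral value \<open>\<nu>\<close> is the only one in a disc around \<open>\<mu>\<^sub>0\<close> of fixed radius. Since
  \<open>A + B\<close> commutes with complex conjugation, the conjugate of \<open>\<nu>\<close> is a spectral value in the
  same disc, so \<open>\<nu>\<close> is real.

  For the strong positivity, fix \<open>\<beta>\<close> slightly above \<open>\<mu>\<^sub>0\<close>. At \<open>\<beta>\<close> the Neumann series shows that the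
  resolvent of \<open>A + B\<close> dominates that of \<open>A\<close>, as \<open>B\<close> is positive
  (\<open>resolvent_positive_perturbation\<close>). As long as no spectral value is met, a positive resolvent
  increases when the spectral parameter decreases (\<open>positive_resolvent_antimono\<close>); hence the strong
  positivity at \<open>\<beta>\<close> extends to the whole interval between \<open>\<nu>\<close> and \<open>\<beta>\<close>.\<close>

section \<open>Bounded operators and Neumann series\<close>

lemma bounded_bilinear_scaleC:
  "bounded_bilinear (\<lambda>(c :: complex) (x :: 'a::complex_normed_vector). c *\<^sub>C x)"
proof
  fix r :: real and c d :: complex and x y :: 'a
  have real: "(r *\<^sub>R x) = complex_of_real r *\<^sub>C x" for x :: 'a
    by (simp add: scaleC_of_real)
  show "(r *\<^sub>R c) *\<^sub>C x = r *\<^sub>R (c *\<^sub>C x)" "c *\<^sub>C (r *\<^sub>R x) = r *\<^sub>R (c *\<^sub>C x)"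
    by (simp_all add: real scaleC_scaleC scaleR_conv_of_real mult.commute)
  show "\<exists>K. \<forall>(c::complex) (x::'a). norm (c *\<^sub>C x) \<le> norm c * norm x * K"
    by (intro exI[of _ 1]) (simp add: norm_scaleC)
qed (simp_all add: scaleC_add_left scaleC_add_right)

interpretation scaleC: bounded_bilinear "\<lambda>(c :: complex) (x :: 'a::complex_normed_vector). c *\<^sub>C x"
  by (rule bounded_bilinear_scaleC)

declare scaleC.zero_left [simp] scaleC.zero_right [simp]

lemma scaleC_one [simp]: "1 *\<^sub>C x = (x :: 'a::complex_normed_vector)"
  using scaleC_of_real[of 1 x] by simp

lemma scaleC_minus_one [simp]: "(- 1) *\<^sub>C x = - (x :: 'a::complex_normed_vector)"
  by (simp add: scaleC.minus_left)

lemmas scaleC_simps = scaleC.add_left scaleC.add_right scaleC.diff_left scaleC.diff_right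
  scaleC.minus_left scaleC.minus_right scaleC_scaleC

lemma scaleC_cancel_left:
  fixes x y :: "'a::complex_normed_vector"
  assumes "c \<noteq> 0" "c *\<^sub>C x = c *\<^sub>C y" shows "x = y"
  using arg_cong[OF assms(2), of "\<lambda>v. inverse c *\<^sub>C v"] assms(1) by (simp add: scaleC_scaleC)

lemma scaleC_eq_0_iff [simp]: "c *\<^sub>C x = 0 \<longleftrightarrow> c = 0 \<or> x = (0 :: 'a::complex_normed_vector)"
  using scaleC_cancel_left[of c x 0] by auto

text \<open>The type of bounded operators only records real linearity.\<close>

definition complex_homogeneous ::
    "('a::complex_normed_vector \<Rightarrow>\<^sub>L 'b::complex_normed_vector) \<Rightarrow> bool" where
  "complex_homogeneous T \<longleftrightarrow> (\<forall>c x. T (c *\<^sub>C x) = c *\<^sub>C T x)"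

lemma complex_homogeneousD: "complex_homogeneous T \<Longrightarrow> T (c *\<^sub>C x) = c *\<^sub>C T x"
  by (simp add: complex_homogeneous_def)

lemma complex_homogeneous_ops:
  "complex_homogeneous (id_blinfun :: 'a::complex_normed_vector \<Rightarrow>\<^sub>L 'a)"
  "complex_homogeneous S \<Longrightarrow> complex_homogeneous T \<Longrightarrow> complex_homogeneous (S + T)"
  "complex_homogeneous S \<Longrightarrow> complex_homogeneous T \<Longrightarrow> complex_homogeneous (S - T)"
  "complex_homogeneous T \<Longrightarrow> complex_homogeneous (c *\<^sub>C T)"
  "complex_homogeneous U \<Longrightarrow> complex_homogeneous V \<Longrightarrow> complex_homogeneous (U o\<^sub>L V)"
  by (simp_all add: complex_homogeneous_def scaleC_simps blinfun.bilinear_simps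
        scaleC_blinfun.rep_eq mult.commute)

lemma complex_homogeneous_limit:
  fixes T :: "'i \<Rightarrow> 'a::complex_normed_vector \<Rightarrow>\<^sub>L 'b::complex_normed_vector"
  assumes "(T \<longlongrightarrow> T') F" "F \<noteq> bot" "\<forall>\<^sub>F i in F. complex_homogeneous (T i)"
  shows "complex_homogeneous T'"
  unfolding complex_homogeneous_def
proof (intro allI)
  fix c x
  have "((\<lambda>i. T i (c *\<^sub>C x)) \<longlongrightarrow> T' (c *\<^sub>C x)) F"
    by (intro blinfun.tendsto assms tendsto_const)
  moreover have "((\<lambda>i. c *\<^sub>C T i x) \<longlongrightarrow> c *\<^sub>C T' x) F"
    by (intro scaleC.tendsto blinfun.tendsto assms tendsto_const)
  moreover have "\<forall>\<^sub>F i in F. T i (c *\<^sub>C x) = c *\<^sub>C T i x"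
    using assms(3) by eventually_elim (rule complex_homogeneousD)
  ultimately show "T' (c *\<^sub>C x) = c *\<^sub>C T' x"
    using tendsto_unique[OF assms(2)] by (simp add: tendsto_cong)
qed

primrec blinfun_power :: "('a::real_normed_vector \<Rightarrow>\<^sub>L 'a) \<Rightarrow> nat \<Rightarrow> 'a \<Rightarrow>\<^sub>L 'a" where
  "blinfun_power X 0 = id_blinfun"
| "blinfun_power X (Suc n) = X o\<^sub>L blinfun_power X n"

lemma blinfun_power_commutes: "blinfun_power X n o\<^sub>L X = X o\<^sub>L blinfun_power X n"
proof (rule blinfun_eqI)
  show "(blinfun_power X n o\<^sub>L X) x = (X o\<^sub>L blinfun_power X n) x" for x
    by (induction n) simp_all
qed

lemma norm_blinfun_power: "norm (blinfun_power X n) \<le> norm X ^ n"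
proof (induction n)
  case 0
  show ?case using norm_blinfun_id_le by simp
next
  case (Suc n)
  have "norm (X o\<^sub>L blinfun_power X n) \<le> norm X * norm (blinfun_power X n)"
    by (rule norm_blinfun_compose)
  also have "\<dots> \<le> norm X * norm X ^ n" using Suc by (intro mult_left_mono) auto
  finally show ?case by simp
qed

lemma blinfun_power_scaleC:
  assumes "complex_homogeneous S"
  shows "blinfun_power (c *\<^sub>C S) n = c ^ n *\<^sub>C blinfun_power S n"
proof (induction n)
  case (Suc n)
  show ?case
    by (rule blinfun_eqI)
      (simp add: Suc scaleC_blinfun.rep_eq complex_homogeneousD[OF assms] scaleC_scaleC)
qed simp

text \<open>The sum \<open>N\<close> is characterised by its two fixed-point equations, which say that it is a right
  and a left inverse of \<open>I - X\<close>; the series itself is needed only for positivity and for Laurent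
  expansions.\<close>

lemma neumann_series:
  fixes X :: "'a::banach \<Rightarrow>\<^sub>L 'a"
  assumes X: "norm X < 1"
  obtains N where "blinfun_power X sums N"
    and "\<And>x. N x = x + X (N x)" and "\<And>x. N (x - X x) = x"
    and "norm N \<le> 1 / (1 - norm X)"
proof -
  have geo: "summable (\<lambda>n. norm X ^ n)" using X by (simp add: summable_geometric)
  have norms: "summable (\<lambda>n. norm (blinfun_power X n))"
    by (rule summable_comparison_test'[OF geo, of 0]) (simp add: norm_blinfun_power)
  define N where "N = suminf (blinfun_power X)"
  have N: "blinfun_power X sums N"
    unfolding N_def by (rule summable_sums[OF summable_norm_cancel[OF norms]])
  have tail: "(\<lambda>n. blinfun_power X (Suc n)) sums (N - id_blinfun)"
    unfolding sums_Suc_iff using N by simp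
  have "(\<lambda>n. X o\<^sub>L blinfun_power X n) sums (X o\<^sub>L N)"
    by (rule bounded_linear.sums[OF bounded_bilinear.bounded_linear_right
          [OF bounded_bilinear_blinfun_compose] N])
  then have XN: "X o\<^sub>L N = N - id_blinfun" using sums_unique2[OF _ tail] by simp
  have "(\<lambda>n. blinfun_power X n o\<^sub>L X) sums (N o\<^sub>L X)"
    by (rule bounded_linear.sums[OF bounded_bilinear.bounded_linear_left
          [OF bounded_bilinear_blinfun_compose] N])
  then have NX: "N o\<^sub>L X = N - id_blinfun"
    using sums_unique2[OF _ tail] by (simp add: blinfun_power_commutes)
  show thesis
  proof
    show "blinfun_power X sums N" by (fact N)
    show "N x = x + X (N x)" for x
      using arg_cong[OF XN, of "\<lambda>T. blinfun_apply T x"] by (simp add: blinfun.bilinear_simps)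
    show "N (x - X x) = x" for x
      using arg_cong[OF NX, of "\<lambda>T. blinfun_apply T x"] by (simp add: blinfun.bilinear_simps)
    have "norm N \<le> (\<Sum>n. norm (blinfun_power X n))"
      unfolding N_def by (rule summable_norm[OF norms])
    also have "\<dots> \<le> (\<Sum>n. norm X ^ n)"
      by (rule suminf_le[OF norm_blinfun_power norms geo])
    also have "\<dots> = 1 / (1 - norm X)" using X by (simp add: suminf_geometric)
    finally show "norm N \<le> 1 / (1 - norm X)" .
  qed
qed

lemma complex_homogeneous_neumann:
  fixes X N :: "'a::{banach,complex_normed_vector} \<Rightarrow>\<^sub>L 'a"
  assumes X: "complex_homogeneous X"
    and N: "\<And>x. N x = x + X (N x)" "\<And>x. N (x - X x) = x"
  shows "complex_homogeneous N"
  unfolding complex_homogeneous_def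
proof (intro allI)
  fix c x
  have "c *\<^sub>C N x - X (c *\<^sub>C N x) = c *\<^sub>C (N x - X (N x))"
    by (simp add: complex_homogeneousD[OF X] scaleC_simps)
  also have "N x - X (N x) = x" using N(1)[of x] by (metis add_diff_cancel_right')
  finally have "c *\<^sub>C N x - X (c *\<^sub>C N x) = c *\<^sub>C x" .
  from N(2)[of "c *\<^sub>C N x", unfolded this] show "N (c *\<^sub>C x) = c *\<^sub>C N x" .
qed

section \<open>Resolvents as two-sided inverses\<close>

lemma complex_linear_onD:
  assumes "complex_linear_on D C"
  shows "x \<in> D \<Longrightarrow> y \<in> D \<Longrightarrow> x + y \<in> D"
    and "x \<in> D \<Longrightarrow> y \<in> D \<Longrightarrow> C (x + y) = C x + C y"
    and "x \<in> D \<Longrightarrow> c *\<^sub>C x \<in> D"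
    and "x \<in> D \<Longrightarrow> C (c *\<^sub>C x) = c *\<^sub>C C x"
  using assms by (simp_all add: complex_linear_on_def)

lemma complex_linear_on_add_blinfun:
  assumes "complex_linear_on D A" "complex_homogeneous B"
  shows "complex_linear_on D (\<lambda>x. A x + B x)"
  using assms by (simp add: complex_linear_on_def complex_homogeneous_def blinfun.add_right scaleC_add_right)

text \<open>Working with this relation, and not with the function \<open>resolvent\<close>, makes every resolvent
  identity below a computation with two algebraic equations.\<close>

definition inverts ::
    "'a::complex_normed_vector set \<Rightarrow> ('a \<Rightarrow> 'a) \<Rightarrow> complex \<Rightarrow> ('a \<Rightarrow>\<^sub>L 'a) \<Rightarrow> bool" where
  "inverts D C z R \<longleftrightarrow>
     (\<forall>y. R y \<in> D \<and> z *\<^sub>C R y - C (R y) = y) \<and> (\<forall>x\<in>D. R (z *\<^sub>C x - C x) = x)"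

lemma inverts_resolvent:
  assumes "z \<in> resolvent_set D C" shows "inverts D C z (resolvent D C z)"
proof -
  let ?f = "\<lambda>x. z *\<^sub>C x - C x"
  have bij: "bij_betw ?f D UNIV" and bl: "bounded_linear (the_inv_into D ?f)"
    using assms by (auto simp: resolvent_set_def)
  have R: "blinfun_apply (resolvent D C z) = the_inv_into D ?f"
    unfolding resolvent_def by (rule bounded_linear_Blinfun_apply[OF bl])
  show ?thesis
    unfolding inverts_def R
    using bij the_inv_into_into[of ?f D _ D] f_the_inv_into_f[of ?f D] the_inv_into_f_f[of ?f D]
    by (auto simp: bij_betw_def)
qed

lemma inverts_imp_resolvent:
  assumes R: "inverts D C z R"
  shows "z \<in> resolvent_set D C" and "resolvent D C z = R"
proof -
  let ?f = "\<lambda>x. z *\<^sub>C x - C x"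
  have inj: "inj_on ?f D" using R by (intro inj_on_inverseI[of _ R]) (simp add: inverts_def)
  have surj: "?f ` D = UNIV"
  proof -
    have "y \<in> ?f ` D" for y
      using R by (intro image_eqI[of _ _ "R y"]) (simp_all add: inverts_def)
    then show ?thesis by blast
  qed
  have "the_inv_into D ?f y = R y" for y
    using R by (intro the_inv_into_f_eq[OF inj]) (auto simp: inverts_def)
  then have eq: "the_inv_into D ?f = blinfun_apply R" by auto
  show "z \<in> resolvent_set D C"
    using inj surj by (simp add: resolvent_set_def bij_betw_def eq blinfun.bounded_linear_right)
  show "resolvent D C z = R"
    unfolding resolvent_def eq by (rule blinfun_apply_inverse)
qed

lemma inverts_homogeneous:
  assumes "complex_linear_on D C" and R: "inverts D C z R"
  shows "complex_homogeneous R"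
  unfolding complex_homogeneous_def
proof (intro allI)
  fix c y
  have D: "c *\<^sub>C R y \<in> D" and "C (c *\<^sub>C R y) = c *\<^sub>C C (R y)"
    using assms by (auto simp: complex_linear_on_def inverts_def)
  then have "z *\<^sub>C (c *\<^sub>C R y) - C (c *\<^sub>C R y) = c *\<^sub>C (z *\<^sub>C R y - C (R y))"
    by (simp add: scaleC_simps mult.commute)
  also have "\<dots> = c *\<^sub>C y" using R by (simp add: inverts_def)
  finally show "R (c *\<^sub>C y) = c *\<^sub>C R y" using R D by (metis inverts_def)
qed

text \<open>Factorisation \<open>z - C - X = (I - X R) (z - C)\<close>: inverting the first factor by a Neumann
  series keeps \<open>z\<close> in the resolvent set.\<close>

lemma inverts_bounded_perturbation:
  fixes X N :: "'a::{banach,complex_normed_vector} \<Rightarrow>\<^sub>L 'a"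
  assumes R: "inverts D C z R"
    and N: "\<And>x. N x = x + (X o\<^sub>L R) (N x)" "\<And>x. N (x - (X o\<^sub>L R) x) = x"
  shows "inverts D (\<lambda>x. C x + X x) z (R o\<^sub>L N)"
  unfolding inverts_def
proof (intro conjI allI ballI)
  fix y
  show "(R o\<^sub>L N) y \<in> D" using R by (simp add: inverts_def)
  have "z *\<^sub>C R (N y) - C (R (N y)) = N y" using R by (simp add: inverts_def)
  then show "z *\<^sub>C (R o\<^sub>L N) y - (C ((R o\<^sub>L N) y) + X ((R o\<^sub>L N) y)) = y"
    using N(1)[of y] by (simp add: algebra_simps)
next
  fix x assume "x \<in> D"
  then have x: "R (z *\<^sub>C x - C x) = x" using R by (simp add: inverts_def)
  have "N (z *\<^sub>C x - (C x + X x)) = N ((z *\<^sub>C x - C x) - (X o\<^sub>L R) (z *\<^sub>C x - C x))"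
    by (simp add: x algebra_simps)
  also have "\<dots> = z *\<^sub>C x - C x" by (rule N(2))
  finally show "(R o\<^sub>L N) (z *\<^sub>C x - (C x + X x)) = x" by (simp add: x)
qed

section \<open>Simple poles\<close>

text \<open>These equations hold when \<open>P\<close> is the spectral projection at a simple pole \<open>\<mu>\<close> and \<open>S\<close> the
  reduced resolvent, that is, the inverse of \<open>\<mu> - C\<close> on the kernel of \<open>P\<close>, extended by zero.
  Conversely, they determine the whole Laurent expansion of the resolvent at \<open>\<mu>\<close>, so that
  a perturbed pole can be found by constructing \<open>P\<close> and \<open>S\<close> algebraically,
  without contour integrals. The choice \<open>P = 0\<close> is possible when \<open>\<mu>\<close> is a regular point.\<close>

definition simple_pole_data ::
    "'a::complex_normed_vector set \<Rightarrow> ('a \<Rightarrow> 'a) \<Rightarrow> complex \<Rightarrow> ('a \<Rightarrow>\<^sub>L 'a) \<Rightarrow> ('a \<Rightarrow>\<^sub>L 'a) \<Rightarrow> bool" where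
  "simple_pole_data D C \<mu> P S \<longleftrightarrow>
     complex_homogeneous P \<and> complex_homogeneous S \<and>
     (\<forall>x. P x \<in> D \<and> C (P x) = \<mu> *\<^sub>C P x) \<and>
     (\<forall>y. S y \<in> D \<and> \<mu> *\<^sub>C S y - C (S y) = y - P y) \<and>
     (\<forall>x\<in>D. S (\<mu> *\<^sub>C x - C x) = x - P x) \<and>
     (\<forall>y. P (S y) = 0)"

context
  fixes D :: "'a::{banach,complex_normed_vector} set" and C \<mu> P S
  assumes lin: "complex_linear_on D C" and data: "simple_pole_data D C \<mu> P S"
begin

lemma simple_pole_P: "P x \<in> D" "C (P x) = \<mu> *\<^sub>C P x"
  and simple_pole_S: "S y \<in> D" "\<mu> *\<^sub>C S y - C (S y) = y - P y"
  and simple_pole_S_left: "x \<in> D \<Longrightarrow> S (\<mu> *\<^sub>C x - C x) = x - P x"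
  and simple_pole_PS: "P (S y) = 0"
  and simple_pole_hom: "complex_homogeneous P" "complex_homogeneous S"
  using data by (auto simp: simple_pole_data_def)

lemma simple_pole_SP: "S (P y) = 0"
proof -
  have "S (y - P y) = S y"
    using simple_pole_S_left[of "S y"] by (simp add: simple_pole_S simple_pole_PS)
  then show ?thesis by (simp add: blinfun.bilinear_simps)
qed

text \<open>Apply \<open>\<mu> - C\<close> to \<open>x = P x + S (\<mu> x - C x)\<close>: the first summand is annihilated and the second
  one returns \<open>\<mu> x - C x\<close> minus its image under \<open>P\<close>.\<close>

lemma simple_pole_P_left:
  assumes "x \<in> D" shows "P (\<mu> *\<^sub>C x - C x) = 0"
proof -
  let ?y = "\<mu> *\<^sub>C x - C x"
  have x: "x = P x + S ?y" using assms by (simp add: simple_pole_S_left)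
  have "C x = C (P x) + C (S ?y)" using x complex_linear_onD(2)[OF lin] simple_pole_P(1) simple_pole_S(1) by metis
  then have "?y = (\<mu> *\<^sub>C P x - C (P x)) + (\<mu> *\<^sub>C S ?y - C (S ?y))"
    using x by (metis add_diff_add scaleC_add_right)
  then show ?thesis by (simp add: simple_pole_P simple_pole_S)
qed

text \<open>With \<open>t = z - \<mu>\<close> and \<open>N = (I + t S)\<^sup>-\<^sup>1\<close>, the operator \<open>S N\<close> inverts \<open>z - C\<close> on the kernel
  of \<open>P\<close>, while on the range of \<open>P\<close> the operator \<open>z - C\<close> is multiplication by \<open>t\<close>.\<close>

lemma inverts_near_simple_pole:
  fixes N :: "'a \<Rightarrow>\<^sub>L 'a"
  assumes z: "z \<noteq> \<mu>"
    and N: "\<And>x. N x = x + (- (z - \<mu>) *\<^sub>C S) (N x)" "\<And>x. N (x - (- (z - \<mu>) *\<^sub>C S) x) = x"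
  shows "inverts D C z (inverse (z - \<mu>) *\<^sub>C P + (S o\<^sub>L N))"
proof -
  define t where "t = z - \<mu>"
  have z: "z = \<mu> + t" and t: "t \<noteq> 0" using z by (auto simp: t_def)
  note hom = complex_homogeneousD[OF simple_pole_hom(1)] complex_homogeneousD[OF simple_pole_hom(2)]
  have N1: "N x + t *\<^sub>C S (N x) = x" for x
  proof -
    have "(- (z - \<mu>) *\<^sub>C S) (N x) = - (t *\<^sub>C S (N x))"
      unfolding scaleC_blinfun.rep_eq t_def by (rule scaleC.minus_left)
    then show ?thesis using N(1)[of x] by (metis add.assoc add.right_neutral left_minus)
  qed
  have N2: "N (x + t *\<^sub>C S x) = x" for x
  proof -
    have "(- (z - \<mu>) *\<^sub>C S) x = - (t *\<^sub>C S x)"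
      unfolding scaleC_blinfun.rep_eq t_def by (rule scaleC.minus_left)
    then show ?thesis using N(2)[of x] by simp
  qed
  have NS: "N (S x) = S (N x)" for x
  proof -
    have "S x = S (N x) + t *\<^sub>C S (S (N x))"
      using arg_cong[OF N1[of x], of S] by (simp add: blinfun.bilinear_simps hom)
    then show ?thesis using N2 by simp
  qed
  have PN: "P (N y) = P y" for y
    using arg_cong[OF N1[of y], of P]
    by (simp add: blinfun.bilinear_simps hom simple_pole_PS)
  have NP: "N (P x) = P x" for x
    using N2[of "P x"] by (simp add: simple_pole_SP)
  let ?R = "inverse t *\<^sub>C P + (S o\<^sub>L N)"
  have "inverts D C z ?R"
    unfolding inverts_def
  proof (intro conjI allI ballI)
    fix y
    have R: "?R y = inverse t *\<^sub>C P y + S (N y)"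
      by (simp add: blinfun.bilinear_simps scaleC_blinfun.rep_eq)
    show "?R y \<in> D" unfolding R by (intro complex_linear_onD[OF lin] simple_pole_P simple_pole_S)
    have "C (?R y) = \<mu> *\<^sub>C (inverse t *\<^sub>C P y) + C (S (N y))"
      unfolding R using simple_pole_P simple_pole_S by (simp add: complex_linear_onD[OF lin] scaleC_simps mult.commute)
    then have "z *\<^sub>C ?R y - C (?R y)
        = P y + (\<mu> *\<^sub>C S (N y) - C (S (N y))) + t *\<^sub>C S (N y)"
      unfolding R z using t by (simp add: scaleC_simps algebra_simps)
    also have "\<dots> = N y + t *\<^sub>C S (N y)" by (simp add: simple_pole_S PN)
    finally show "z *\<^sub>C ?R y - C (?R y) = y" by (simp add: N1)
  next
    fix x assume x: "x \<in> D"
    have eq: "z *\<^sub>C x - C x = (\<mu> *\<^sub>C x - C x) + t *\<^sub>C x"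
      by (simp add: z scaleC_simps algebra_simps)
    have "P (z *\<^sub>C x - C x) = t *\<^sub>C P x"
      unfolding eq using simple_pole_P_left[OF x] by (simp add: blinfun.add_right hom)
    moreover have "S (N (z *\<^sub>C x - C x)) = x - P x"
    proof -
      have "S (N (z *\<^sub>C x - C x)) = N (S (z *\<^sub>C x - C x))" by (simp only: NS)
      also have "S (z *\<^sub>C x - C x) = (x - P x) + t *\<^sub>C S x"
        unfolding eq by (simp only: blinfun.add_right hom simple_pole_S_left[OF x])
      also have "\<dots> = (x + t *\<^sub>C S x) - P x" by simp
      also have "N \<dots> = x - P x" by (simp add: blinfun.diff_right N2 NP)
      finally show ?thesis .
    qed
    ultimately show "?R (z *\<^sub>C x - C x) = x"
      using t by (simp add: blinfun.add_left scaleC_blinfun.rep_eq scaleC_scaleC)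
  qed
  then show ?thesis by (simp add: t_def)
qed

definition laurent_coeff :: "nat \<Rightarrow> 'a \<Rightarrow>\<^sub>L 'a" where
  "laurent_coeff n = (-1) ^ n *\<^sub>C blinfun_power S (Suc n)"

lemma norm_laurent_coeff: "norm (laurent_coeff n) \<le> norm S ^ Suc n"
  using norm_blinfun_power[of S "Suc n"]
  by (simp add: laurent_coeff_def norm_scaleC norm_power)

text \<open>The punctured disc obtained here has radius \<open>1 / norm S\<close>. A bound on \<open>S\<close> that is uniform in
  the perturbation therefore isolates the perturbed spectral value in a disc of fixed size.\<close>

lemma resolvent_near_simple_pole:
  assumes z: "z \<noteq> \<mu>" and small: "cmod (z - \<mu>) * norm S < 1"
  shows "z \<in> resolvent_set D C"
    and "(\<lambda>n. (z - \<mu>) ^ n *\<^sub>C laurent_coeff n) sums (resolvent D C z - inverse (z - \<mu>) *\<^sub>C P)"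
    and "norm (resolvent D C z) \<le> norm P / cmod (z - \<mu>) + norm S / (1 - cmod (z - \<mu>) * norm S)"
proof -
  let ?X = "- (z - \<mu>) *\<^sub>C S"
  have nX: "norm ?X = cmod (z - \<mu>) * norm S" by (simp only: norm_scaleC norm_minus_cancel)
  obtain N where N: "blinfun_power ?X sums N" "\<And>x. N x = x + ?X (N x)" "\<And>x. N (x - ?X x) = x"
      "norm N \<le> 1 / (1 - norm ?X)"
    using neumann_series[of ?X] small unfolding nX by metis
  note inv = inverts_near_simple_pole[OF z N(2,3)]
  show "z \<in> resolvent_set D C" by (rule inverts_imp_resolvent[OF inv])
  have res: "resolvent D C z = inverse (z - \<mu>) *\<^sub>C P + (S o\<^sub>L N)"
    by (rule inverts_imp_resolvent[OF inv])
  have "(\<lambda>n. S o\<^sub>L blinfun_power ?X n) sums (S o\<^sub>L N)"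
    by (rule bounded_linear.sums[OF bounded_bilinear.bounded_linear_right
          [OF bounded_bilinear_blinfun_compose] N(1)])
  moreover have "S o\<^sub>L blinfun_power ?X n = (z - \<mu>) ^ n *\<^sub>C laurent_coeff n" for n
  proof (rule blinfun_eqI)
    fix x
    have "(- (z - \<mu>)) ^ n = (z - \<mu>) ^ n * (-1) ^ n"
      using power_mult_distrib[of "-1" "z - \<mu>" n] by (simp add: mult.commute)
    then show "(S o\<^sub>L blinfun_power ?X n) x = ((z - \<mu>) ^ n *\<^sub>C laurent_coeff n) x"
      by (simp add: blinfun_power_scaleC[OF simple_pole_hom(2)] laurent_coeff_def
          scaleC_blinfun.rep_eq complex_homogeneousD[OF simple_pole_hom(2)] scaleC_scaleC del: minus_diff_eq)
  qed
  ultimately show "(\<lambda>n. (z - \<mu>) ^ n *\<^sub>C laurent_coeff n) sums (resolvent D C z - inverse (z - \<mu>) *\<^sub>C P)"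
    by (simp add: res)
  have "norm (resolvent D C z) \<le> norm (inverse (z - \<mu>) *\<^sub>C P) + norm (S o\<^sub>L N)"
    unfolding res by (rule norm_triangle_ineq)
  also have "norm (inverse (z - \<mu>) *\<^sub>C P) = norm P / cmod (z - \<mu>)"
    by (simp add: norm_scaleC norm_inverse divide_inverse mult.commute)
  also have "norm (S o\<^sub>L N) \<le> norm S * norm N" by (rule norm_blinfun_compose)
  also have "\<dots> \<le> norm S * (1 / (1 - norm ?X))" by (intro mult_left_mono N) simp
  also have "\<dots> = norm S / (1 - cmod (z - \<mu>) * norm S)" by (simp only: nX times_divide_eq_right mult_1_right)
  finally show "norm (resolvent D C z) \<le> norm P / cmod (z - \<mu>) + norm S / (1 - cmod (z - \<mu>) * norm S)"
    by simp
qed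

lemma pole_of_resolvent_simple:
  assumes "P \<noteq> 0" shows "pole_of_resolvent D C \<mu>"
proof -
  define \<rho> where "\<rho> = 1 / (norm S + 1)"
  have \<rho>: "\<rho> > 0" "\<rho> * norm S < 1"
    unfolding \<rho>_def using norm_ge_zero[of S] by (auto simp: divide_less_eq add_nonneg_pos)
  define Q where "Q = case_nat P laurent_coeff"
  have "z \<in> resolvent_set D C \<and> (\<lambda>n. (z - \<mu>) powi (int n - int 1) *\<^sub>C Q n) sums resolvent D C z"
    if "z \<in> ball \<mu> \<rho> - {\<mu>}" for z
  proof
    have z: "z \<noteq> \<mu>" and "cmod (z - \<mu>) < \<rho>" using that by (auto simp: dist_norm norm_minus_commute)
    then have small: "cmod (z - \<mu>) * norm S < 1"
      using \<rho>(2) mult_right_mono[of "cmod (z - \<mu>)" \<rho> "norm S"] by auto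
    show "z \<in> resolvent_set D C" by (rule resolvent_near_simple_pole(1)[OF z small])
    let ?h = "\<lambda>n. (z - \<mu>) powi (int n - int 1) *\<^sub>C Q n"
    have h0: "?h 0 = inverse (z - \<mu>) *\<^sub>C P" by (simp add: Q_def)
    have "?h (Suc n) = (z - \<mu>) ^ n *\<^sub>C laurent_coeff n" for n by (simp add: Q_def)
    then have "(\<lambda>n. ?h (Suc n)) sums (resolvent D C z - inverse (z - \<mu>) *\<^sub>C P)"
      using resolvent_near_simple_pole(2)[OF z small] by presburger
    from sums_Suc[OF this] show "?h sums resolvent D C z" unfolding h0 by simp
  qed
  moreover have "Q 0 \<noteq> 0" using assms by (simp add: Q_def)
  ultimately show ?thesis
    unfolding pole_of_resolvent_def using \<rho>(1)
    by (intro exI[of _ 1] exI[of _ Q] exI[of _ \<rho>] conjI ballI) auto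
qed

text \<open>On the circle the Laurent series is integrated term by term: the principal part contributes
  \<open>2 \<pi> \<i> P\<close>, and every other term has a periodic primitive.\<close>

lemma spectral_projection_simple: "is_spectral_projection D C \<mu> P"
proof -
  define \<rho> where "\<rho> = 1 / (2 * (norm S + 1))"
  have \<rho>: "\<rho> > 0" "\<rho> * norm S < 1"
    unfolding \<rho>_def using norm_ge_zero[of S] by (auto simp: divide_less_eq add_nonneg_pos)
  define e where "e t = exp (2 * of_real pi * \<i> * complex_of_real t)" for t :: real
  have e_norm: "cmod (e t) = 1" and e_nz: "e t \<noteq> 0" for t by (simp_all add: e_def)
  have on_circle: "circlepath \<mu> \<rho> t - \<mu> = \<rho> * e t" for t
    by (simp add: circlepath e_def)
  have deriv: "vector_derivative (circlepath \<mu> \<rho>) (at t within {0..1}) = 2 * pi * \<i> * (\<rho> * e t)"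
    if "t \<in> {0..1}" for t
    using that by (simp add: vector_derivative_circlepath01 e_def)
  have res: "z \<in> resolvent_set D C" if "z \<in> cball \<mu> \<rho> - {\<mu>}" for z
  proof (rule resolvent_near_simple_pole(1))
    have "cmod (z - \<mu>) \<le> \<rho>" using that by (auto simp: dist_norm norm_minus_commute)
    then show "cmod (z - \<mu>) * norm S < 1"
      using \<rho>(2) mult_right_mono[of "cmod (z - \<mu>)" \<rho> "norm S"] by auto
  qed (use that in auto)
  define f where "f n t = (2 * pi * \<i> * (\<rho> * e t) ^ Suc n) *\<^sub>C laurent_coeff n" for n t
  define g where "g t = (\<Sum>n. f n t)" for t
  have bound: "norm (f n t) \<le> 2 * pi * (\<rho> * norm S) ^ Suc n" for n t
  proof -
    have "norm (f n t) = (2 * pi * \<rho> ^ Suc n) * norm (laurent_coeff n)"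
      unfolding f_def norm_scaleC using \<rho>(1) e_norm[of t]
      by (simp only: norm_mult norm_power norm_of_real norm_ii abs_of_pos pi_gt_zero norm_numeral) simp
    also have "\<dots> \<le> (2 * pi * \<rho> ^ Suc n) * norm S ^ Suc n"
      using \<rho>(1) by (intro mult_left_mono norm_laurent_coeff) auto
    finally show ?thesis by (simp add: power_mult_distrib mult_ac)
  qed
  have summ: "summable (\<lambda>n. 2 * pi * (\<rho> * norm S) ^ Suc n)"
    using \<rho> by (intro summable_mult) (simp add: summable_geometric summable_Suc_iff del: power_Suc)
  have unif: "uniform_limit {0..1} (\<lambda>n t. \<Sum>i<n. f i t) g sequentially"
    unfolding g_def by (rule Weierstrass_m_test[OF bound summ])
  have f_int: "(f n has_integral 0) {0..1}" for n
  proof -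
    let ?G = "\<lambda>z. inverse (of_nat (Suc n)) * (\<rho> * exp (2 * of_real pi * \<i> * z)) ^ Suc n"
    let ?F = "\<lambda>t :: real. ?G (complex_of_real t)"
    have G: "(?G has_field_derivative 2 * pi * \<i> * (\<rho> * exp (2 * of_real pi * \<i> * z)) ^ Suc n) (at z)" for z
    proof -
      have inner: "((\<lambda>z::complex. \<rho> * exp (2 * of_real pi * \<i> * z)) has_field_derivative
          2 * pi * \<i> * (\<rho> * exp (2 * of_real pi * \<i> * z))) (at z)"
        by (auto intro!: derivative_eq_intros)
      have Suc: "1 + of_nat n = (of_nat (Suc n) :: complex)" by simp
      have "inverse (of_nat (Suc n)) * ((1 + of_nat n) * ((c * w) * w ^ n)) = c * w ^ Suc n"
        for c w :: complex
        unfolding Suc by (simp del: of_nat_Suc)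
      then show ?thesis
        by (rule DERIV_cong[OF DERIV_cmult[OF DERIV_power_Suc[OF inner]]])
    qed
    have "(?F has_vector_derivative 2 * pi * \<i> * (\<rho> * e t) ^ Suc n) (at t within {0..1})" for t
      unfolding e_def
      by (rule has_vector_derivative_real_field[where f = ?G]) (rule G)
    then have "((\<lambda>t. 2 * pi * \<i> * (\<rho> * e t) ^ Suc n) has_integral (?F 1 - ?F 0)) {0..1}"
      by (intro fundamental_theorem_of_calculus) auto
    moreover have "?F 1 - ?F 0 = 0" by simp
    ultimately have "((\<lambda>t. 2 * pi * \<i> * (\<rho> * e t) ^ Suc n) has_integral 0) {0..1}" by simp
    from has_integral_linear[OF this scaleC.bounded_linear_left[of "laurent_coeff n"]]
    show ?thesis by (simp add: f_def[abs_def] o_def)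
  qed
  have cont: "continuous_on {0..1} (\<lambda>t. \<Sum>i<n. f i t)" for n
    unfolding f_def e_def
    by (intro continuous_on_sum scaleC.continuous_on continuous_on_mult continuous_on_power
        continuous_on_exp continuous_on_const continuous_on_of_real continuous_on_id)
  obtain I J where IJ: "\<And>n. ((\<lambda>t. \<Sum>i<n. f i t) has_integral I n) {0..1}"
      "(g has_integral J) {0..1}" "I \<longlonglongrightarrow> J"
    by (rule uniform_limit_integral[OF unif cont sequentially_bot]) (rule that)
  have "((\<lambda>t. \<Sum>i<n. f i t) has_integral (\<Sum>i<n. 0)) {0..1}" for n
    by (rule has_integral_sum) (simp, rule f_int)
  then have "I n = 0" for n
    using has_integral_unique[OF IJ(1)[of n]] by (metis sum.neutral_const)
  then have "I = (\<lambda>n. 0)" by (intro ext)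
  then have "J = 0" using LIMSEQ_unique[OF IJ(3)] by (metis tendsto_const)
  then have g_int: "(g has_integral 0) {0..1}" using IJ(2) by simp
  have int: "((\<lambda>t. (2 * of_real pi * \<i>) *\<^sub>C P + g t) has_integral ((2 * of_real pi * \<i>) *\<^sub>C P + 0)) {0..1}"
    using has_integral_add[OF has_integral_const_real[of "(2 * of_real pi * \<i>) *\<^sub>C P" 0 1] g_int]
    by simp
  have eq: "(2 * of_real pi * \<i>) *\<^sub>C P + g t =
      vector_derivative (circlepath \<mu> \<rho>) (at t within {0..1}) *\<^sub>C resolvent D C (circlepath \<mu> \<rho> t)"
    if t: "t \<in> {0..1}" for t
  proof -
    let ?z = "circlepath \<mu> \<rho> t"
    let ?d = "2 * pi * \<i> * (\<rho> * e t)"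
    have z: "?z \<noteq> \<mu>" using on_circle[of t] \<rho>(1) e_nz[of t] by auto
    have small: "cmod (?z - \<mu>) * norm S < 1" using \<rho> e_norm[of t] by (simp add: on_circle norm_mult)
    have "(\<lambda>n. ?d *\<^sub>C ((?z - \<mu>) ^ n *\<^sub>C laurent_coeff n)) sums
        (?d *\<^sub>C (resolvent D C ?z - inverse (?z - \<mu>) *\<^sub>C P))"
      by (rule bounded_linear.sums[OF bounded_linear_scaleC resolvent_near_simple_pole(2)[OF z small]])
    moreover have "?d *\<^sub>C ((?z - \<mu>) ^ n *\<^sub>C laurent_coeff n) = f n t" for n
      unfolding f_def on_circle scaleC_scaleC by (simp add: mult.assoc)
    ultimately have "g t = ?d *\<^sub>C (resolvent D C ?z - inverse (?z - \<mu>) *\<^sub>C P)"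
      unfolding g_def by (simp add: sums_iff)
    also have "\<dots> = ?d *\<^sub>C resolvent D C ?z - (?d * inverse (?z - \<mu>)) *\<^sub>C P"
      by (simp only: scaleC.diff_right scaleC_scaleC)
    also have "?d * inverse (?z - \<mu>) = 2 * of_real pi * \<i>"
    proof -
      have cancel: "a * w * inverse w = a" if "w \<noteq> 0" for a w :: complex using that by simp
      have "\<rho> * e t \<noteq> 0" using \<rho>(1) e_nz[of t] by simp
      then show ?thesis unfolding on_circle by (subst cancel) simp_all
    qed
    finally show ?thesis by (simp add: deriv[OF t])
  qed
  have "((\<lambda>t. vector_derivative (circlepath \<mu> \<rho>) (at t within {0..1}) *\<^sub>C
               resolvent D C (circlepath \<mu> \<rho> t))
         has_integral (2 * of_real pi * \<i>) *\<^sub>C P) {0..1}"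
    using has_integral_eq[OF eq int] by simp
  then show ?thesis unfolding is_spectral_projection_def using \<rho>(1) res by blast
qed

end

section \<open>Positive projections on Banach lattices\<close>

lemma closed_nonneg_banach_lattice: "closed {x :: 'a::banach_lattice. 0 \<le> x}"
  by (auto simp: closed_sequential_limits intro: banach_lattice_limit_nonneg)

lemma banach_lattice_archimedean:
  fixes v w :: "'a::banach_lattice"
  assumes "\<And>n. real (Suc n) *\<^sub>R v \<le> w" shows "v \<le> 0"
proof (rule banach_lattice_limit_mono)
  show "(\<lambda>n. v) \<longlonglongrightarrow> v" by (rule tendsto_const)
  show "(\<lambda>n. inverse (real (Suc n)) *\<^sub>R w) \<longlonglongrightarrow> 0"
    using tendsto_scaleR[OF LIMSEQ_inverse_real_of_nat tendsto_const[of w]] by simp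
  fix n
  have "inverse (real (Suc n)) *\<^sub>R (real (Suc n) *\<^sub>R v) \<le> inverse (real (Suc n)) *\<^sub>R w"
    by (rule scaleR_left_mono[OF assms]) simp
  then show "v \<le> inverse (real (Suc n)) *\<^sub>R w" by simp
qed

text \<open>Strict positivity of \<open>p\<close> makes its fixed space a sublattice. Two nonzero disjoint positive fixed
  vectors would both dominate a multiple of \<open>u\<close>, which is impossible; so every fixed vector is
  positive or negative. A totally ordered Archimedean space is one-dimensional, by connectedness of
  the real line.\<close>

lemma positive_projection_rank_one:
  fixes p :: "'a::banach_lattice \<Rightarrow> 'a"
  assumes lin: "linear p" and pos: "\<And>x. 0 \<le> x \<Longrightarrow> 0 \<le> p x" and idem: "\<And>x. p (p x) = p x"
    and strict: "\<And>x. 0 \<le> x \<Longrightarrow> p x = 0 \<Longrightarrow> x = 0"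
    and u: "0 \<le> u" "u \<noteq> 0"
    and lower: "\<And>x. 0 \<le> x \<Longrightarrow> x \<noteq> 0 \<Longrightarrow> p x = x \<Longrightarrow> \<exists>\<epsilon>>0. \<epsilon> *\<^sub>R u \<le> x"
  shows "\<exists>c. p x = c *\<^sub>R p u"
proof -
  define v where "v = p u"
  have v: "0 \<le> v" "v \<noteq> 0" "p v = v" using u pos strict[of u] by (auto simp: v_def idem)
  have mono: "p x \<le> p y" if "x \<le> y" for x y
    using pos[of "y - x"] that by (simp add: linear_diff[OF lin])
  have abs_fixed: "p \<bar>y\<bar> = \<bar>y\<bar>" if y: "p y = y" for y
  proof -
    have "y \<le> p \<bar>y\<bar>" using mono[OF abs_ge_self[of y]] y by simp
    moreover have "- y \<le> p \<bar>y\<bar>"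
      using mono[OF abs_ge_minus_self[of y]] y by (simp add: linear_neg[OF lin])
    ultimately have "\<bar>y\<bar> \<le> p \<bar>y\<bar>" by (rule abs_leI)
    then have "p \<bar>y\<bar> - \<bar>y\<bar> = 0"
      by - (rule strict, simp_all add: linear_diff[OF lin] idem)
    then show ?thesis by simp
  qed
  have dichotomy: "0 \<le> y \<or> y \<le> 0" if y: "p y = y" for y
  proof (rule ccontr)
    assume no_sign: "\<not> (0 \<le> y \<or> y \<le> 0)"
    let ?a = "\<bar>y\<bar> + y" and ?b = "\<bar>y\<bar> - y"
    have ge: "0 \<le> ?a" "0 \<le> ?b"
      using add_right_mono[OF abs_ge_minus_self[of y], of y] abs_ge_self[of y] by simp_all
    have ne: "?a \<noteq> 0" "?b \<noteq> 0"
    proof -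
      show "?a \<noteq> 0"
      proof
        assume "?a = 0"
        then have "y = - \<bar>y\<bar>" by (simp only: eq_neg_iff_add_eq_0 add.commute)
        then have "y \<le> 0" using abs_ge_zero[of y] by (metis neg_le_0_iff_le)
        then show False using no_sign by simp
      qed
      show "?b \<noteq> 0"
      proof
        assume "?b = 0"
        then have "\<bar>y\<bar> = y" by (simp only: right_minus_eq)
        then have "0 \<le> y" using abs_ge_zero[of y] by (rule subst)
        then show False using no_sign by simp
      qed
    qed
    have fixed: "p ?a = ?a" "p ?b = ?b"
      by (simp_all add: linear_add[OF lin] linear_diff[OF lin] y abs_fixed[OF y])
    obtain \<epsilon> where \<epsilon>: "\<epsilon> > 0" "\<epsilon> *\<^sub>R u \<le> ?a" using lower[OF ge(1) ne(1) fixed(1)] by blast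
    obtain \<delta> where \<delta>: "\<delta> > 0" "\<delta> *\<^sub>R u \<le> ?b" using lower[OF ge(2) ne(2) fixed(2)] by blast
    \<comment> \<open>\<open>?a\<close> and \<open>?b\<close> are twice the positive and the negative part of \<open>y\<close>, hence disjoint.\<close>
    have "min \<epsilon> \<delta> *\<^sub>R u \<le> ?a" "min \<epsilon> \<delta> *\<^sub>R u \<le> ?b"
      by (rule order_trans[OF scaleR_right_mono[OF _ u(1)] \<epsilon>(2)], simp)
        (rule order_trans[OF scaleR_right_mono[OF _ u(1)] \<delta>(2)], simp)
    then have "min \<epsilon> \<delta> *\<^sub>R u \<le> inf ?a ?b" by simp
    also have "inf ?a ?b = \<bar>y\<bar> + inf y (- y)" by (simp add: add_inf_distrib_left)
    also have "inf y (- y) = - \<bar>y\<bar>"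
      by (simp only: inf_eq_neg_sup[of y "- y"] abs_lattice[of y] minus_minus sup.commute[of "- y" y])
    also have "\<bar>y\<bar> + - \<bar>y\<bar> = 0" by (rule right_minus)
    finally have "inverse (min \<epsilon> \<delta>) *\<^sub>R (min \<epsilon> \<delta> *\<^sub>R u) \<le> inverse (min \<epsilon> \<delta>) *\<^sub>R 0"
      using \<epsilon>(1) \<delta>(1) by (intro scaleR_left_mono) auto
    moreover have "min \<epsilon> \<delta> \<noteq> 0" using \<epsilon>(1) \<delta>(1) by (simp add: min_def)
    ultimately have "u \<le> 0" by simp
    then show False using u by simp
  qed
  define y where "y = p x"
  define T1 where "T1 = {t. 0 \<le> y - t *\<^sub>R v}"
  define T2 where "T2 = {t. 0 \<le> t *\<^sub>R v - y}"
  have "p (y - t *\<^sub>R v) = y - t *\<^sub>R v" for t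
    by (simp add: linear_diff[OF lin] linear_scale[OF lin] v y_def idem)
  then have cover: "UNIV \<subseteq> T1 \<union> T2"
    using dichotomy[of "y - t *\<^sub>R v" for t] by (fastforce simp: T1_def T2_def)
  have "closed ((\<lambda>t. y - t *\<^sub>R v) -` {x. 0 \<le> x})" "closed ((\<lambda>t. t *\<^sub>R v - y) -` {x. 0 \<le> x})"
    by (intro closed_vimage closed_nonneg_banach_lattice continuous_intros)+
  then have closed: "closed T1" "closed T2"
    by (simp_all only: T1_def T2_def vimage_def mem_Collect_eq)
  have not_le: "\<not> (\<forall>t. t *\<^sub>R v \<le> w)" for w
    using banach_lattice_archimedean[of v w] v by auto
  have "T1 \<noteq> {}"
  proof
    assume "T1 = {}"
    then have "y \<le> t *\<^sub>R v" for t using cover by (auto simp: T2_def)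
    from this[of "- t" for t] have "t *\<^sub>R v \<le> - y" for t
      by (simp only: scaleR_minus_left le_minus_iff)
    then show False using not_le by blast
  qed
  moreover have "T2 \<noteq> {}"
  proof
    assume "T2 = {}"
    then have "t *\<^sub>R v \<le> y" for t using cover by (auto simp: T1_def)
    then show False using not_le by blast
  qed
  ultimately have "T1 \<inter> T2 \<noteq> {}"
    using connected_UNIV[where 'a = real] closed cover unfolding connected_closed by blast
  then obtain t where "t \<in> T1" "t \<in> T2" by blast
  then have "y = t *\<^sub>R v" by (simp add: T1_def T2_def)
  then show ?thesis unfolding y_def v_def ..
qed

section \<open>Positivity in the complexification\<close>

lemma scaleC_sel [simp]:
  "re (c *\<^sub>C z) = Re c *\<^sub>R re z - Im c *\<^sub>R im z" "im (c *\<^sub>C z) = Re c *\<^sub>R im z + Im c *\<^sub>R re z"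
  by (simp_all add: scaleC_complexification_def)

lemma nonneg_complexification_iff: "0 \<le> z \<longleftrightarrow> 0 \<le> re z \<and> im z = 0"
  by (auto simp: less_eq_complexification_def)

lemma cartesian_complexification: "z = Cx (re z) 0 + \<i> *\<^sub>C Cx (im z) 0"
  by (simp add: complexification_eq_iff)

lemma complex_homogeneous_cartesian:
  assumes "complex_homogeneous T" shows "T x = T (Cx (re x) 0) + \<i> *\<^sub>C T (Cx (im x) 0)"
proof -
  have "T x = T (Cx (re x) 0 + \<i> *\<^sub>C Cx (im x) 0)"
    using cartesian_complexification[of x] by (rule arg_cong)
  then show ?thesis by (simp only: blinfun.add_right complex_homogeneousD[OF assms])
qed

lemma norm_re_le: "norm (re z) \<le> norm z" and norm_im_le: "norm (im z) \<le> norm z"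
  using banach_lattice_norm_mono[OF _ abs_re_le_modulus[of z]]
    banach_lattice_norm_mono[OF _ abs_im_le_modulus[of z]]
  by (simp_all add: norm_complexification_def)

lemma bounded_linear_re: "bounded_linear re" and bounded_linear_im: "bounded_linear im"
  by (auto intro!: bounded_linear_intro[where K = 1] simp: norm_re_le norm_im_le)

lemma closed_nonneg_complexification: "closed {z :: 'a::banach_lattice complexification. 0 \<le> z}"
proof -
  have "{z :: 'a complexification. 0 \<le> z} = re -` {x. 0 \<le> x} \<inter> im -` {0}"
    by (auto simp: nonneg_complexification_iff)
  moreover have "closed (re -` {x :: 'a. 0 \<le> x})"
    by (rule closed_vimage[OF closed_nonneg_banach_lattice linear_continuous_on[OF bounded_linear_re]])
  moreover have "closed (im -` {0 :: 'a})"
    by (rule closed_vimage[OF closed_singleton linear_continuous_on[OF bounded_linear_im]])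
  ultimately show ?thesis by (simp add: closed_Int)
qed

lemma tendsto_nonneg_complexification:
  fixes f :: "'i \<Rightarrow> 'a::banach_lattice complexification"
  assumes "(f \<longlongrightarrow> l) F" "F \<noteq> bot" "\<forall>\<^sub>F i in F. 0 \<le> f i" shows "0 \<le> l"
  using Lim_in_closed_set[OF closed_nonneg_complexification _ assms(2,1)] assms(3) by simp

lemma positive_operatorD: "positive_operator T \<Longrightarrow> 0 \<le> f \<Longrightarrow> 0 \<le> T f"
  by (simp add: positive_operator_def)

lemma positive_operator_mono: "positive_operator T \<Longrightarrow> f \<le> g \<Longrightarrow> T f \<le> T g"
  using positive_operatorD[of T "g - f"] by (simp add: blinfun.diff_right)

lemma positive_operator_real:
  assumes "positive_operator T" shows "im (T (Cx x 0)) = 0"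
proof -
  have "Cx x 0 = Cx (pprt x) 0 - Cx (- nprt x) 0"
    using prts[of x] by (simp add: complexification_eq_iff)
  moreover have "0 \<le> Cx (pprt x) 0" "0 \<le> Cx (- nprt x) 0"
    by (simp_all add: nonneg_complexification_iff)
  from this[THEN positive_operatorD[OF assms]]
  have "0 \<le> T (Cx (pprt x) 0)" "0 \<le> T (Cx (- nprt x) 0)" .
  ultimately show ?thesis by (simp add: blinfun.diff_right nonneg_complexification_iff)
qed

text \<open>Positivity propagates \<open>T u = 0\<close> to the ideal generated by \<open>u\<close>, which is dense.\<close>

lemma positive_operator_zero:
  assumes T: "positive_operator T" and hom: "complex_homogeneous T"
    and u: "quasi_interior_point u" and Tu: "T u = 0"
  shows "T = 0"
proof -
  have real: "T (Cx y 0) = 0" if y: "\<bar>y\<bar> \<le> c *\<^sub>R re u" for y c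
  proof -
    have im: "im u = 0" using u by (simp add: quasi_interior_point_def nonneg_complexification_iff)
    have "Cx y 0 \<le> c *\<^sub>R u" "- (c *\<^sub>R u) \<le> Cx y 0"
      using order_trans[OF abs_ge_self y] order_trans[OF abs_ge_minus_self y] im
      by (auto simp: less_eq_complexification_def minus_le_iff)
    from this[THEN positive_operator_mono[OF T]] show ?thesis
      by (simp add: blinfun.bilinear_simps Tu)
  qed
  have "T x = 0" if x: "x \<in> principal_ideal u" for x
  proof -
    obtain c where "\<bar>x\<bar> \<le> c *\<^sub>R u" using x unfolding principal_ideal_def by blast
    then have "modulus x \<le> c *\<^sub>R re u"
      by (simp add: abs_complexification_def less_eq_complexification_def)
    then have "T (Cx (re x) 0) = 0" "T (Cx (im x) 0) = 0"
      using order_trans[OF abs_re_le_modulus[of x]] order_trans[OF abs_im_le_modulus[of x]]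
      by (auto intro!: real[of _ c])
    then show ?thesis using complex_homogeneous_cartesian[OF hom, of x] by simp
  qed
  then have "principal_ideal u \<subseteq> T -` {0}" by auto
  moreover have "closed (T -` {0})"
    by (intro closed_vimage closed_singleton continuous_intros)
  ultimately have "closure (principal_ideal u) \<subseteq> T -` {0}" by (rule closure_minimal)
  then show ?thesis using u by (auto simp: quasi_interior_point_def intro!: blinfun_eqI)
qed

text \<open>All terms of the Neumann series for the perturbed resolvent are positive, and the first one is
  the unperturbed resolvent.\<close>

lemma resolvent_positive_perturbation:
  fixes D :: "'a::banach_lattice complexification set"
  assumes z: "z \<in> resolvent_set D C" and R: "positive_operator (resolvent D C z)"
    and X: "positive_operator X" and small: "norm X * norm (resolvent D C z) < 1"
  shows "z \<in> resolvent_set D (\<lambda>x. C x + X x)"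
    and "\<And>f. 0 \<le> f \<Longrightarrow> resolvent D C z f \<le> resolvent D (\<lambda>x. C x + X x) z f"
proof -
  let ?R = "resolvent D C z" and ?Y = "X o\<^sub>L resolvent D C z"
  have "norm ?Y < 1" using norm_blinfun_compose[of X ?R] small by simp
  then obtain N where N: "blinfun_power ?Y sums N" "\<And>x. N x = x + ?Y (N x)" "\<And>x. N (x - ?Y x) = x"
    using neumann_series by metis
  note inv = inverts_bounded_perturbation[OF inverts_resolvent[OF z] N(2,3)]
  show "z \<in> resolvent_set D (\<lambda>x. C x + X x)" by (rule inverts_imp_resolvent[OF inv])
  fix f :: "'a complexification" assume f: "0 \<le> f"
  have "0 \<le> blinfun_power ?Y n f" for n
    using f by (induction n) (auto intro: positive_operatorD[OF X] positive_operatorD[OF R])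
  then have "0 \<le> (\<Sum>i<n. blinfun_power ?Y i) f" for n
    by (simp add: blinfun.sum_left sum_nonneg)
  moreover have "(\<lambda>n. (\<Sum>i<n. blinfun_power ?Y i) f) \<longlonglongrightarrow> N f"
    using N(1) unfolding sums_def by (intro blinfun.tendsto tendsto_const)
  ultimately have "0 \<le> N f" by (intro tendsto_nonneg_complexification) auto
  then have "0 \<le> ?Y (N f)" by (simp add: positive_operatorD[OF X] positive_operatorD[OF R])
  then have "f \<le> N f" by (subst N(2)) simp
  then have "?R f \<le> ?R (N f)" by (rule positive_operator_mono[OF R])
  then show "?R f \<le> resolvent D (\<lambda>x. C x + X x) z f"
    by (simp add: inverts_imp_resolvent(2)[OF inv])
qed

section \<open>Complex conjugation\<close>

definition conjugation :: "'a::banach_lattice complexification \<Rightarrow> 'a complexification" where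
  "conjugation z = Cx (re z) (- im z)"

lemma conjugation_simps [simp]:
  "re (conjugation z) = re z" "im (conjugation z) = - im z"
  "conjugation (conjugation z) = z"
  by (simp_all add: conjugation_def complexification_eq_iff)

lemma conjugation_ops:
  "conjugation (z + w) = conjugation z + conjugation w"
  "conjugation (z - w) = conjugation z - conjugation w"
  "conjugation (c *\<^sub>C z) = cnj c *\<^sub>C conjugation z"
  by (simp_all add: complexification_eq_iff)

lemma bounded_linear_conjugation: "bounded_linear conjugation"
proof (rule bounded_linear_intro[where K = 1])
  fix z :: "'a complexification"
  have "modulus (conjugation z) \<le> modulus z"
  proof (rule modulus_least)
    fix t
    show "cos t *\<^sub>R re (conjugation z) + sin t *\<^sub>R im (conjugation z) \<le> modulus z"
      using modulus_upper[of "- t" z] by simp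
  qed
  then show "norm (conjugation z) \<le> norm z * 1"
    unfolding norm_complexification_def mult_1_right
    by (rule banach_lattice_norm_mono[OF modulus_nonneg])
qed (simp_all add: complexification_eq_iff)

lemma real_operator_conjugation:
  assumes lin: "complex_linear_on D A" and real: "real_operator D A" and x: "x \<in> D"
  shows "conjugation x \<in> D" and "A (conjugation x) = conjugation (A x)"
proof -
  obtain a b where ab: "a \<in> D" "b \<in> D" "im a = 0" "im b = 0" "x = a + \<i> *\<^sub>C b"
  proof -
    have "x \<in> {x + \<i> *\<^sub>C y | x y. x \<in> real_space \<inter> D \<and> y \<in> real_space \<inter> D}"
      using real x unfolding real_operator_def by blast
    then show ?thesis using that by (auto simp: real_space_def)
  qed
  have Aab: "im (A a) = 0" "im (A b) = 0"
    using real ab by (auto simp: real_operator_def real_space_def)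
  have conj: "conjugation x = a + (- \<i>) *\<^sub>C b" using ab by (simp add: complexification_eq_iff)
  have D: "c *\<^sub>C b \<in> D" "A (a + c *\<^sub>C b) = A a + c *\<^sub>C A b" "a + c *\<^sub>C b \<in> D" for c
    using lin ab by (simp_all add: complex_linear_on_def)
  show "conjugation x \<in> D" unfolding conj by (rule D)
  show "A (conjugation x) = conjugation (A x)"
    unfolding conj unfolding ab(5) D(2) using Aab by (simp add: complexification_eq_iff)
qed

lemma positive_operator_conjugation:
  assumes T: "positive_operator T" and hom: "complex_homogeneous T"
  shows "T (conjugation x) = conjugation (T x)"
proof -
  note complex_homogeneous_cartesian[OF hom, of x]
  moreover have "conjugation x = Cx (re x) 0 + (- \<i>) *\<^sub>C Cx (im x) 0"
    by (simp add: complexification_eq_iff)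
  then have "T (conjugation x) = T (Cx (re x) 0) + (- \<i>) *\<^sub>C T (Cx (im x) 0)"
    by (simp only: blinfun.add_right complex_homogeneousD[OF hom])
  ultimately show ?thesis
    using positive_operator_real[OF T] by (simp add: complexification_eq_iff)
qed

text \<open>If \<open>C\<close> commutes with conjugation then its spectrum is symmetric about the real axis. This is
  what makes an isolated perturbed spectral value near a real number real.\<close>

lemma resolvent_set_cnj:
  fixes D :: "'a::banach_lattice complexification set"
  assumes C: "\<And>x. x \<in> D \<Longrightarrow> conjugation x \<in> D" "\<And>x. x \<in> D \<Longrightarrow> C (conjugation x) = conjugation (C x)"
    and z: "z \<in> resolvent_set D C"
  shows "cnj z \<in> resolvent_set D C"
proof -
  define J where "J = Blinfun (conjugation :: 'a complexification \<Rightarrow> 'a complexification)"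
  have J: "blinfun_apply J = conjugation"
    unfolding J_def by (rule bounded_linear_Blinfun_apply[OF bounded_linear_conjugation])
  let ?R = "resolvent D C z"
  have R: "?R y \<in> D" "z *\<^sub>C ?R y - C (?R y) = y" "x \<in> D \<Longrightarrow> ?R (z *\<^sub>C x - C x) = x" for x y
    using inverts_resolvent[OF z] by (auto simp: inverts_def)
  have "inverts D C (cnj z) (J o\<^sub>L ?R o\<^sub>L J)"
    unfolding inverts_def
  proof (intro conjI allI ballI)
    fix y
    show "(J o\<^sub>L ?R o\<^sub>L J) y \<in> D" by (simp add: J C(1) R(1))
    have "cnj z *\<^sub>C conjugation (?R (conjugation y)) - C (conjugation (?R (conjugation y)))
        = conjugation (z *\<^sub>C ?R (conjugation y) - C (?R (conjugation y)))"
      by (simp only: conjugation_ops C(2)[OF R(1)])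
    then show "cnj z *\<^sub>C (J o\<^sub>L ?R o\<^sub>L J) y - C ((J o\<^sub>L ?R o\<^sub>L J) y) = y"
      by (simp add: J R(2))
  next
    fix x assume x: "x \<in> D"
    have "conjugation (cnj z *\<^sub>C x - C x) = z *\<^sub>C conjugation x - C (conjugation x)"
      by (simp only: conjugation_ops C(2)[OF x] complex_cnj_cnj)
    then show "(J o\<^sub>L ?R o\<^sub>L J) (cnj z *\<^sub>C x - C x) = x"
      by (simp add: J R(3)[OF C(1)[OF x]])
  qed
  then show ?thesis by (rule inverts_imp_resolvent)
qed

section \<open>The dominant pole of the unperturbed operator\<close>

text \<open>The positivity hypothesis concerns real points to the right of the pole, so one-sided limits
  along the reals are all that is required. The second limit is the first one for the shifted
  series.\<close>

lemma vector_power_series_limits: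
  fixes Q :: "nat \<Rightarrow> 'b::banach"
  assumes \<rho>: "\<rho> > 0" and h: "\<And>t. 0 < t \<Longrightarrow> t < \<rho> \<Longrightarrow> (\<lambda>n. t ^ n *\<^sub>R Q n) sums h t"
  shows "(h \<longlongrightarrow> Q 0) (at_right 0)"
    and "((\<lambda>t. inverse t *\<^sub>R (h t - Q 0)) \<longlongrightarrow> Q 1) (at_right 0)"
proof -
  have limit: "(h \<longlongrightarrow> Q 0) (at_right 0)"
    if h: "\<And>t. 0 < t \<Longrightarrow> t < \<rho> \<Longrightarrow> (\<lambda>n. t ^ n *\<^sub>R Q n) sums h t" for h :: "real \<Rightarrow> 'b" and Q
  proof -
    define s where "s = \<rho> / 2"
    have s: "0 < s" "s < \<rho>" using \<rho> by (simp_all add: s_def)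
    obtain M where M: "\<And>n. norm (s ^ n *\<^sub>R Q n) \<le> M"
      using summable_imp_bounded[OF sums_summable[OF h[OF s]]] by (auto simp: bounded_iff)
    define g where "g t = (\<Sum>n. t ^ n *\<^sub>R Q n)" for t
    have "uniform_limit {0..s/2} (\<lambda>n t. \<Sum>i<n. t ^ i *\<^sub>R Q i) g sequentially"
      unfolding g_def
    proof (rule Weierstrass_m_test)
      fix n t assume t: "t \<in> {0..s/2}"
      have "norm (t ^ n *\<^sub>R Q n) = (t / s) ^ n * norm (s ^ n *\<^sub>R Q n)"
        using t s by (simp add: power_divide)
      also have "\<dots> \<le> (1/2) ^ n * M"
        using t s by (intro mult_mono power_mono M) (auto simp: field_simps)
      finally show "norm (t ^ n *\<^sub>R Q n) \<le> M * (1/2) ^ n" by (simp only: mult.commute)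
    next
      show "summable (\<lambda>n. M * (1/2) ^ n :: real)" by (intro summable_mult summable_geometric) simp
    qed
    then have "continuous_on {0..s/2} g"
      by (rule uniform_limit_theorem[rotated])
        (auto intro!: always_eventually continuous_intros)
    then have "(g \<longlongrightarrow> g 0) (at 0 within {0..s/2})" using s by (simp add: continuous_on_def)
    then have lim: "(g \<longlongrightarrow> g 0) (at_right 0)" using s by (simp add: at_within_Icc_at_right)
    have "g 0 = Q 0" unfolding g_def by (subst suminf_finite[of "{0}"]) auto
    moreover have "\<forall>\<^sub>F t in at_right 0. g t = h t"
    proof -
      have "\<forall>\<^sub>F t in at_right 0. t \<in> {0<..<\<rho>}" using \<rho> by (rule eventually_at_right_real)
      then show ?thesis by eventually_elim (use h in \<open>auto simp: g_def sums_iff\<close>)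
    qed
    ultimately show ?thesis using lim by (simp add: tendsto_cong)
  qed
  show "(h \<longlongrightarrow> Q 0) (at_right 0)" by (rule limit[OF h])
  have "(\<lambda>n. t ^ n *\<^sub>R Q (Suc n)) sums (inverse t *\<^sub>R (h t - Q 0))" if t: "0 < t" "t < \<rho>" for t
  proof -
    have "(\<lambda>n. t ^ Suc n *\<^sub>R Q (Suc n)) sums (h t - Q 0)"
      using iffD2[OF sums_Suc_iff[of "\<lambda>n. t ^ n *\<^sub>R Q n" "h t - Q 0"]] h[OF t]
      by (simp del: power_Suc)
    from sums_scaleR_right[OF this, of "inverse t"] show ?thesis using t by (simp flip: mult.assoc)
  qed
  from limit[OF this] show "((\<lambda>t. inverse t *\<^sub>R (h t - Q 0)) \<longlongrightarrow> Q 1) (at_right 0)" by simp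
qed

lemma closed_operator_limit:
  assumes C: "closed_operator D C" and F: "F \<noteq> bot"
    and D: "\<forall>\<^sub>F i in F. f i \<in> D" and f: "(f \<longlongrightarrow> x) F" and Cf: "((\<lambda>i. C (f i)) \<longlongrightarrow> y) F"
  shows "x \<in> D" and "C x = y"
proof -
  have "\<forall>\<^sub>F i in F. (f i, C (f i)) \<in> {(x, C x) | x. x \<in> D}" using D by eventually_elim auto
  with C[unfolded closed_operator_def] have "(x, y) \<in> {(x, C x) | x. x \<in> D}"
    using F tendsto_Pair[OF f Cf] by (rule Lim_in_closed_set)
  then show "x \<in> D" "C x = y" by auto
qed

text \<open>Let \<open>H t\<close> be the resolvent at \<open>\<mu> + t\<close>, let \<open>m\<close> be the order of the pole, and let \<open>P\<close> be
  the leading coefficient, i.e. the limit of \<open>t\<^sup>m H t\<close> as \<open>t\<close> decreases to \<open>0\<close>. It is a positive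
  nonzero operator into the eigenspace of \<open>\<mu>\<close>; since \<open>u\<close> is quasi-interior, \<open>P u\<close> is nonzero.
  As \<open>H t x = x / t\<close> on the eigenspace, strong positivity of \<open>H t\<close> makes every positive eigenvector
  dominate a multiple of \<open>u\<close>. Two consequences follow. First, the pole is simple: if \<open>m \<ge> 2\<close> then
  \<open>P\<close> would annihilate its own eigenvector \<open>P u\<close> and thus also \<open>u\<close>. Second, \<open>P\<close> is strictly
  positive and its positive fixed vectors dominate \<open>u\<close>, so it has rank one. The remaining equations
  say that the next Laurent coefficient \<open>S\<close> is the reduced resolvent; they are limits of the
  resolvent equations, where closedness of \<open>A\<close> is used.\<close>

lemma dominant_pole:
  fixes D :: "'a::banach_lattice complexification set"
  assumes lin: "complex_linear_on D A" and closed: "closed_operator D A"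
    and pole: "pole_of_resolvent D A (complex_of_real \<mu>)"
    and u: "quasi_interior_point u"
    and pos: "resolvent_unif_ev_strongly_positive D A u \<mu>"
  obtains P S v where "simple_pole_data D A (complex_of_real \<mu>) P S"
    and "v \<noteq> 0" and "P v = v" and "\<And>x. \<exists>c. P x = c *\<^sub>C v"
proof -
  let ?F = "at_right (0::real)"
  obtain m Q \<rho> where m: "m \<ge> 1" and Q0: "Q 0 \<noteq> 0" and \<rho>: "\<rho> > 0"
    and laurent: "\<And>z. z \<in> ball (complex_of_real \<mu>) \<rho> - {complex_of_real \<mu>} \<Longrightarrow> z \<in> resolvent_set D A \<and>
           (\<lambda>n. (z - complex_of_real \<mu>) powi (int n - int m) *\<^sub>C Q n) sums resolvent D A z"
    using pole unfolding pole_of_resolvent_def by blast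
  obtain \<mu>\<^sub>1 where \<mu>\<^sub>1: "\<mu>\<^sub>1 > \<mu>" and strong: "\<And>z f. \<mu> < z \<Longrightarrow> z \<le> \<mu>\<^sub>1 \<Longrightarrow> 0 < f \<Longrightarrow>
      strongly_positive u (resolvent D A (complex_of_real z) f)"
    using pos unfolding resolvent_unif_ev_strongly_positive_def by (metis greaterThanAtMost_iff)
  have u0: "0 \<le> u" using u by (simp add: quasi_interior_point_def)
  define H where "H t = resolvent D A (complex_of_real (\<mu> + t))" for t
  define G where "G t = t ^ m *\<^sub>R H t" for t
  define \<delta> where "\<delta> = min \<rho> (\<mu>\<^sub>1 - \<mu>)"
  have \<delta>: "\<delta> > 0" using \<rho> \<mu>\<^sub>1 by (simp add: \<delta>_def)
  have small: "\<forall>\<^sub>F t in ?F. 0 < t \<and> t < \<delta>"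
    using eventually_at_right_real[OF \<delta>] by simp
  have near: "complex_of_real (\<mu> + t) \<in> ball (complex_of_real \<mu>) \<rho> - {complex_of_real \<mu>}"
    if "0 < t" "t < \<rho>" for t
    using that by (simp add: dist_norm)
  have inv: "inverts D A (complex_of_real (\<mu> + t)) (H t)" if "0 < t" "t < \<rho>" for t
    unfolding H_def using laurent[OF near[OF that]] by (intro inverts_resolvent) simp
  have H: "H t y \<in> D" "A (H t y) = \<mu> *\<^sub>R H t y + t *\<^sub>R H t y - y"
      "x \<in> D \<Longrightarrow> H t (\<mu> *\<^sub>R x + t *\<^sub>R x - A x) = x"
      if "0 < t" "t < \<delta>" for t x y
  proof -
    have t: "0 < t" "t < \<rho>" using that by (simp_all add: \<delta>_def)
    show "H t y \<in> D" using inv[OF t] by (simp add: inverts_def)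
    have "complex_of_real (\<mu> + t) *\<^sub>C H t y - A (H t y) = y" using inv[OF t] by (simp add: inverts_def)
    then show "A (H t y) = \<mu> *\<^sub>R H t y + t *\<^sub>R H t y - y"
      unfolding scaleC_of_real by (simp add: algebra_simps)
    show "H t (\<mu> *\<^sub>R x + t *\<^sub>R x - A x) = x" if "x \<in> D"
      using inv[OF t] that unfolding inverts_def scaleC_of_real by (simp add: scaleR_add_left)
  qed
  have H_hom: "complex_homogeneous (H t)" if "0 < t" "t < \<delta>" for t
    using inverts_homogeneous[OF lin inv] that by (simp add: \<delta>_def)
  have H_strong: "strongly_positive u (H t f)" if "0 < t" "t < \<delta>" "0 < f" for t f
    unfolding H_def using that by (intro strong) (simp_all add: \<delta>_def)
  have H_pos: "0 \<le> H t f" if "0 < t" "t < \<delta>" "0 \<le> f" for t f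
  proof (cases "f = 0")
    case False
    then have "0 < f" using that(3) by (simp add: less_complexification_def)
    from H_strong[OF that(1,2) this] obtain \<epsilon> where "\<epsilon> > 0" "\<epsilon> *\<^sub>R u \<le> H t f"
      by (auto simp: strongly_positive_def)
    then show ?thesis using u0 by (meson order_trans scaleR_nonneg_nonneg less_imp_le)
  qed simp
  have series: "(\<lambda>n. t ^ n *\<^sub>R Q n) sums G t" if t: "0 < t" "t < \<rho>" for t
  proof -
    have "(\<lambda>n. t powi (int n - int m) *\<^sub>R Q n) sums H t"
    proof -
      have "complex_of_real t powi (int n - int m) *\<^sub>C Q n = t powi (int n - int m) *\<^sub>R Q n" for n
        by (simp flip: of_real_power_int add: scaleC_of_real)
      then show ?thesis using laurent[OF near[OF t]] by (simp add: H_def)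
    qed
    from sums_scaleR_right[OF this, of "t ^ m"] show ?thesis
      using t by (simp add: G_def power_int_diff)
  qed
  note limits = vector_power_series_limits[OF \<rho> series]
  define P where "P = Q 0"
  have G: "(G \<longlongrightarrow> P) ?F" unfolding P_def by (rule limits(1))
  have G_apply: "((\<lambda>t. G t x) \<longlongrightarrow> P x) ?F" for x by (intro blinfun.tendsto G tendsto_const)
  have t0: "((\<lambda>t::real. t) \<longlongrightarrow> 0) ?F" by (rule tendsto_ident_at)
  have G_hom: "complex_homogeneous (G t)" if "0 < t" "t < \<delta>" for t
    using complex_homogeneous_ops(4)[OF H_hom[OF that], of "complex_of_real (t ^ m)"]
    unfolding scaleC_of_real G_def .
  have P_hom: "complex_homogeneous P"
    by (rule complex_homogeneous_limit[OF G]) (simp, use small in \<open>eventually_elim, auto intro: G_hom\<close>)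
  have P_pos: "positive_operator P"
    unfolding positive_operator_def
  proof (intro allI impI)
    fix f :: "'a complexification" assume f: "0 \<le> f"
    have "\<forall>\<^sub>F t in ?F. 0 \<le> G t f"
      using small
    proof eventually_elim
      case (elim t)
      then show ?case
        using H_pos[of t f] f by (simp add: G_def blinfun.scaleR_left scaleR_nonneg_nonneg)
    qed
    then show "0 \<le> P f" by (intro tendsto_nonneg_complexification[OF G_apply]) simp_all
  qed
  have Pu: "P u \<noteq> 0"
    using positive_operator_zero[OF P_pos P_hom u] Q0 by (auto simp: P_def)
  have P_range: "P y \<in> D" "A (P y) = \<mu> *\<^sub>R P y" for y
  proof -
    have "\<forall>\<^sub>F t in ?F. G t y \<in> D \<and> A (G t y) = \<mu> *\<^sub>R G t y + t *\<^sub>R G t y - t ^ m *\<^sub>R y"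
      using small
    proof eventually_elim
      case (elim t)
      have "complex_of_real (t ^ m) *\<^sub>C H t y \<in> D \<and>
          A (complex_of_real (t ^ m) *\<^sub>C H t y) = complex_of_real (t ^ m) *\<^sub>C A (H t y)"
        using lin H(1)[of t y] elim by (simp add: complex_linear_on_def)
      then show ?case
        using H(2)[of t y] elim unfolding scaleC_of_real
        by (simp add: G_def blinfun.scaleR_left algebra_simps)
    qed
    then have ev: "\<forall>\<^sub>F t in ?F. G t y \<in> D"
        "\<forall>\<^sub>F t in ?F. \<mu> *\<^sub>R G t y + t *\<^sub>R G t y - t ^ m *\<^sub>R y = A (G t y)"
      by (auto elim: eventually_mono)
    have "((\<lambda>t. \<mu> *\<^sub>R G t y + t *\<^sub>R G t y - t ^ m *\<^sub>R y) \<longlongrightarrow> \<mu> *\<^sub>R P y + 0 *\<^sub>R P y - 0 ^ m *\<^sub>R y) ?F"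
      by (intro tendsto_intros G_apply t0)
    then have "((\<lambda>t. A (G t y)) \<longlongrightarrow> \<mu> *\<^sub>R P y) ?F"
      using tendsto_cong[OF ev(2)] m by (simp add: power_0_left)
    from closed_operator_limit[OF closed _ ev(1) G_apply this]
    show "P y \<in> D" "A (P y) = \<mu> *\<^sub>R P y" by simp_all
  qed
  have H_eigen: "t *\<^sub>R H t x = x" if "0 < t" "t < \<delta>" "x \<in> D" "A x = \<mu> *\<^sub>R x" for t x
    using H(3)[of t x] that by (simp add: blinfun.scaleR_right)
  \<comment> \<open>The point \<open>\<mu> + \<delta>/2\<close> is an arbitrary choice inside the interval of strong positivity.\<close>
  have eigen_lower: "\<exists>\<epsilon>>0. \<epsilon> *\<^sub>R u \<le> x" if x: "0 \<le> x" "x \<noteq> 0" "x \<in> D" "A x = \<mu> *\<^sub>R x" for x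
  proof -
    have t: "0 < \<delta>/2" "\<delta>/2 < \<delta>" using \<delta> by simp_all
    have "0 < x" using x by (simp add: less_complexification_def)
    from H_strong[OF t this] obtain \<epsilon> where \<epsilon>: "\<epsilon> > 0" "\<epsilon> *\<^sub>R u \<le> H (\<delta>/2) x"
      by (auto simp: strongly_positive_def)
    then have "(\<delta>/2) *\<^sub>R (\<epsilon> *\<^sub>R u) \<le> (\<delta>/2) *\<^sub>R H (\<delta>/2) x" using \<delta> by (intro scaleR_left_mono) auto
    also have "\<dots> = x" by (rule H_eigen[OF t x(3,4)])
    finally show ?thesis using \<epsilon>(1) \<delta> by (intro exI[of _ "\<delta>/2 * \<epsilon>"]) simp
  qed
  have P_nonzero: "P x \<noteq> 0" if x: "\<epsilon> > 0" "\<epsilon> *\<^sub>R u \<le> x" for x \<epsilon>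
  proof
    assume "P x = 0"
    then have "\<epsilon> *\<^sub>R P u \<le> 0"
      using positive_operator_mono[OF P_pos x(2)] by (simp add: blinfun.scaleR_right)
    then have "inverse \<epsilon> *\<^sub>R (\<epsilon> *\<^sub>R P u) \<le> inverse \<epsilon> *\<^sub>R 0" using x(1) by (intro scaleR_left_mono) auto
    then have "P u \<le> 0" using x(1) by simp
    then show False using Pu positive_operatorD[OF P_pos u0] by (meson order_antisym)
  qed
  define v where "v = P u"
  have v: "0 \<le> v" "v \<noteq> 0" "v \<in> D" "A v = \<mu> *\<^sub>R v"
    using Pu positive_operatorD[OF P_pos u0] P_range by (simp_all add: v_def)
  have "m = 1"
  proof (rule ccontr)
    assume "m \<noteq> 1"
    define k where "k = m - 2"
    have k: "m = Suc (Suc k)" using m \<open>m \<noteq> 1\<close> by (simp add: k_def)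
    have "\<forall>\<^sub>F t in ?F. t ^ Suc k *\<^sub>R v = G t v"
      using small
    proof eventually_elim
      case (elim t)
      have "G t v = t ^ Suc k *\<^sub>R (t *\<^sub>R H t v)" by (simp add: G_def k blinfun.scaleR_left mult_ac)
      also have "t *\<^sub>R H t v = v" using elim by (intro H_eigen v) auto
      finally show ?case ..
    qed
    moreover have "((\<lambda>t. t ^ Suc k *\<^sub>R v) \<longlongrightarrow> 0 ^ Suc k *\<^sub>R v) ?F" by (intro tendsto_intros t0)
    ultimately have "((\<lambda>t. G t v) \<longlongrightarrow> 0) ?F" by (simp add: tendsto_cong)
    then have "P v = 0" using tendsto_unique[OF _ G_apply] by simp
    then show False using eigen_lower[OF v] P_nonzero by blast
  qed
  then have G_eq: "G t = t *\<^sub>R H t" for t by (simp add: G_def)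
  define S where "S = Q 1"
  define K where "K t = inverse t *\<^sub>R (G t - P)" for t
  have K: "(K \<longlongrightarrow> S) ?F" unfolding K_def[abs_def] P_def S_def by (rule limits(2))
  have K_apply: "((\<lambda>t. K t x) \<longlongrightarrow> S x) ?F" for x by (intro blinfun.tendsto K tendsto_const)
  have K_eq: "K t x = H t x - inverse t *\<^sub>R P x" if "0 < t" for t x
    using that by (simp add: K_def G_eq blinfun.bilinear_simps scaleR_diff_right)
  have P_fixed: "P x = x" if x: "x \<in> D" "A x = \<mu> *\<^sub>R x" for x
  proof -
    have "\<forall>\<^sub>F t in ?F. G t x = x"
      using small by eventually_elim (simp add: G_eq blinfun.scaleR_left H_eigen x)
    then have "((\<lambda>t. G t x) \<longlongrightarrow> x) ?F" by (simp add: tendsto_cong)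
    then show ?thesis using tendsto_unique[OF _ G_apply] by simp
  qed
  have P_idem: "P (P x) = P x" for x by (intro P_fixed P_range)
  have P_left: "P (\<mu> *\<^sub>R x - A x) = 0" if x: "x \<in> D" for x
  proof -
    have "\<forall>\<^sub>F t in ?F. t *\<^sub>R x - t *\<^sub>R G t x = G t (\<mu> *\<^sub>R x - A x)"
      using small
    proof eventually_elim
      case (elim t)
      have "t *\<^sub>R H t (\<mu> *\<^sub>R x + t *\<^sub>R x - A x) = t *\<^sub>R x" using elim x by (simp add: H(3))
      then show ?case by (simp add: G_eq blinfun.bilinear_simps algebra_simps)
    qed
    moreover have "((\<lambda>t. t *\<^sub>R x - t *\<^sub>R G t x) \<longlongrightarrow> 0 *\<^sub>R x - 0 *\<^sub>R P x) ?F"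
      by (intro tendsto_intros t0 G_apply)
    ultimately have "((\<lambda>t. G t (\<mu> *\<^sub>R x - A x)) \<longlongrightarrow> 0) ?F" by (simp add: tendsto_cong)
    then show ?thesis using tendsto_unique[OF _ G_apply] by simp
  qed
  have S_hom: "complex_homogeneous S"
  proof (rule complex_homogeneous_limit[OF K])
    show "\<forall>\<^sub>F t in ?F. complex_homogeneous (K t)"
      using small
    proof eventually_elim
      case (elim t)
      show ?case
        unfolding K_def
        using complex_homogeneous_ops(4)[OF complex_homogeneous_ops(3)[OF G_hom[of t] P_hom],
            of "complex_of_real (inverse t)"] elim
        unfolding scaleC_of_real by simp
    qed
  qed simp
  have S_range: "S y \<in> D" "A (S y) = \<mu> *\<^sub>R S y - y + P y" for y
  proof -
    have "\<forall>\<^sub>F t in ?F. K t y \<in> D \<and> A (K t y) = \<mu> *\<^sub>R K t y + t *\<^sub>R K t y - y + P y"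
      using small
    proof eventually_elim
      case (elim t)
      let ?w = "complex_of_real (- inverse t) *\<^sub>C P y"
      have Hy: "H t y \<in> D" using elim by (simp add: H(1))
      have w: "?w \<in> D" "A ?w = complex_of_real (- inverse t) *\<^sub>C A (P y)"
        using lin P_range(1)[of y] by (simp_all add: complex_linear_on_def)
      have "H t y + ?w \<in> D" "A (H t y + ?w) = A (H t y) + A ?w"
        using lin Hy w(1) by (simp_all add: complex_linear_on_def)
      moreover have "K t y = H t y + ?w"
        unfolding scaleC_of_real using elim by (simp add: K_eq)
      ultimately have "K t y \<in> D" "A (K t y) = A (H t y) - inverse t *\<^sub>R A (P y)"
        unfolding w(2) unfolding scaleC_of_real by simp_all
      then show ?case
        using H(2)[of t y] elim by (simp add: K_eq P_range(2) algebra_simps)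
    qed
    then have ev: "\<forall>\<^sub>F t in ?F. K t y \<in> D"
        "\<forall>\<^sub>F t in ?F. \<mu> *\<^sub>R K t y + t *\<^sub>R K t y - y + P y = A (K t y)"
      by (auto elim: eventually_mono)
    have "((\<lambda>t. \<mu> *\<^sub>R K t y + t *\<^sub>R K t y - y + P y) \<longlongrightarrow> \<mu> *\<^sub>R S y + 0 *\<^sub>R S y - y + P y) ?F"
      by (intro tendsto_intros K_apply t0)
    then have "((\<lambda>t. A (K t y)) \<longlongrightarrow> \<mu> *\<^sub>R S y - y + P y) ?F"
      using tendsto_cong[OF ev(2)] by simp
    from closed_operator_limit[OF closed _ ev(1) K_apply this]
    show "S y \<in> D" "A (S y) = \<mu> *\<^sub>R S y - y + P y" by simp_all
  qed
  have S_left: "S (\<mu> *\<^sub>R x - A x) = x - P x" if x: "x \<in> D" for x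
  proof -
    have "\<forall>\<^sub>F t in ?F. x - P x - t *\<^sub>R K t x = K t (\<mu> *\<^sub>R x - A x)"
      using small
    proof eventually_elim
      case (elim t)
      have "H t (\<mu> *\<^sub>R x - A x) + t *\<^sub>R H t x = x"
        using H(3)[of t x] elim x by (simp add: blinfun.bilinear_simps algebra_simps)
      moreover have "t *\<^sub>R K t x = t *\<^sub>R H t x - P x" using elim by (simp add: K_eq scaleR_diff_right)
      moreover have "K t (\<mu> *\<^sub>R x - A x) = H t (\<mu> *\<^sub>R x - A x)"
        using elim by (simp add: K_eq P_left[OF x])
      ultimately show ?case by (simp add: algebra_simps)
    qed
    moreover have "((\<lambda>t. x - P x - t *\<^sub>R K t x) \<longlongrightarrow> x - P x - 0 *\<^sub>R S x) ?F"
      by (intro tendsto_intros t0 K_apply)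
    ultimately have "((\<lambda>t. K t (\<mu> *\<^sub>R x - A x)) \<longlongrightarrow> x - P x) ?F" by (simp add: tendsto_cong)
    then show ?thesis using tendsto_unique[OF _ K_apply] by simp
  qed
  have PS: "P (S y) = 0" for y
  proof -
    have "P (K t y) = 0" if t: "0 < t" "t < \<delta>" for t
    proof -
      have "P (\<mu> *\<^sub>R H t y - A (H t y)) = 0" by (intro P_left H t)
      then have "P y = t *\<^sub>R P (H t y)" using H(2)[OF t, of y] by (simp add: blinfun.bilinear_simps)
      then have "P (H t y) = inverse t *\<^sub>R P y" using t by simp
      then show ?thesis using t by (simp add: K_eq blinfun.bilinear_simps P_idem)
    qed
    then have "\<forall>\<^sub>F t in ?F. P (K t y) = 0" using small by (auto elim: eventually_mono)
    then have "((\<lambda>t. P (K t y)) \<longlongrightarrow> 0) ?F" by (simp add: tendsto_cong)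
    moreover have "((\<lambda>t. P (K t y)) \<longlongrightarrow> P (S y)) ?F" by (intro blinfun.tendsto tendsto_const K_apply)
    ultimately show ?thesis using tendsto_unique by (metis trivial_limit_at_right_real)
  qed
  have data: "simple_pole_data D A (complex_of_real \<mu>) P S"
    unfolding simple_pole_data_def scaleC_of_real
    using P_hom S_hom P_range S_range S_left PS by simp
  have strict: "f = 0" if f: "0 \<le> f" "P f = 0" for f
  proof (rule ccontr)
    assume "f \<noteq> 0"
    then have "0 < f" using f(1) by (simp add: less_complexification_def)
    have t: "0 < \<delta>/2" "\<delta>/2 < \<delta>" using \<delta> by simp_all
    from H_strong[OF t \<open>0 < f\<close>] have "P (H (\<delta>/2) f) \<noteq> 0"
      using P_nonzero by (auto simp: strongly_positive_def)
    moreover have "P (H (\<delta>/2) f) = inverse (\<delta>/2) *\<^sub>R P f"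
    proof -
      have "P (\<mu> *\<^sub>R H (\<delta>/2) f - A (H (\<delta>/2) f)) = 0" by (intro P_left H t)
      then have "P f = (\<delta>/2) *\<^sub>R P (H (\<delta>/2) f)" using H(2)[OF t, of f] by (simp add: blinfun.bilinear_simps)
      then show ?thesis using \<delta> by simp
    qed
    ultimately show False using f(2) by simp
  qed
  define p where "p x = re (P (Cx x 0))" for x
  have p: "P (Cx x 0) = Cx (p x) 0" for x
    by (simp add: p_def complexification_eq_iff positive_operator_real[OF P_pos])
  have im_u: "u = Cx (re u) 0" using u0 by (simp add: nonneg_complexification_iff complexification_eq_iff)
  have p_rank: "\<exists>c. p x = c *\<^sub>R p (re u)" for x
  proof (rule positive_projection_rank_one[where p = p and u = "re u"])
    show "linear p"
    proof (rule linearI)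
      fix x y :: 'a and r :: real
      have "Cx (x + y) 0 = Cx x 0 + Cx y 0" "Cx (r *\<^sub>R x) 0 = r *\<^sub>R Cx x 0"
        by (simp_all add: complexification_eq_iff)
      then show "p (x + y) = p x + p y" "p (r *\<^sub>R x) = r *\<^sub>R p x"
        by (simp_all add: p_def blinfun.bilinear_simps)
    qed
    show "0 \<le> p x" if "0 \<le> x" for x
      using positive_operatorD[OF P_pos, of "Cx x 0"] that
      by (simp add: p nonneg_complexification_iff)
    show "p (p x) = p x" for x using P_idem[of "Cx x 0"] by (simp add: p)
    show "x = 0" if "0 \<le> x" "p x = 0" for x
    proof -
      have "Cx x 0 = 0"
        using that by - (rule strict, simp_all add: p nonneg_complexification_iff complexification_eq_iff)
      then show ?thesis by (simp add: complexification_eq_iff)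
    qed
    show "0 \<le> re u" using u0 by (simp add: nonneg_complexification_iff)
    show "re u \<noteq> 0" using Pu im_u by (metis blinfun.zero_right zero_complexification_def)
    show "\<exists>\<epsilon>>0. \<epsilon> *\<^sub>R re u \<le> x" if "0 \<le> x" "x \<noteq> 0" "p x = x" for x
    proof -
      have "P (Cx x 0) = Cx x 0" by (simp add: p that)
      then have "Cx x 0 \<in> D" "A (Cx x 0) = \<mu> *\<^sub>R Cx x 0" using P_range[of "Cx x 0"] by simp_all
      moreover have "0 \<le> Cx x 0" "Cx x 0 \<noteq> 0"
        using that by (simp_all add: nonneg_complexification_iff complexification_eq_iff)
      ultimately obtain \<epsilon> where "\<epsilon> > 0" "\<epsilon> *\<^sub>R u \<le> Cx x 0" using eigen_lower by blast
      then show ?thesis by (auto simp: less_eq_complexification_def)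
    qed
  qed
  have real_rank: "\<exists>c. P (Cx x 0) = c *\<^sub>R v" for x
  proof -
    obtain c where "p x = c *\<^sub>R p (re u)" using p_rank by blast
    moreover have "v = Cx (p (re u)) 0" unfolding v_def using p[of "re u"] im_u by simp
    ultimately have "P (Cx x 0) = c *\<^sub>R v" by (simp add: p complexification_eq_iff)
    then show ?thesis ..
  qed
  have rank: "\<exists>c. P x = c *\<^sub>C v" for x
  proof -
    obtain a b where "P (Cx (re x) 0) = a *\<^sub>R v" "P (Cx (im x) 0) = b *\<^sub>R v" using real_rank by metis
    then have "P x = (complex_of_real a + \<i> * complex_of_real b) *\<^sub>C v"
      using complex_homogeneous_cartesian[OF P_hom, of x]
      by (simp add: scaleC_add_left flip: scaleC_of_real scaleC_scaleC)
    then show ?thesis ..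
  qed
  show thesis
    by (rule that[OF data v(2) P_fixed[OF v(3,4)] rank])
qed

section \<open>Perturbation of a simple pole of rank one\<close>

lemma norm_blinfun_le: "norm T \<le> b \<Longrightarrow> norm x \<le> c \<Longrightarrow> norm (blinfun_apply T x) \<le> b * c"
  using norm_blinfun[of T x] mult_mono[of "norm T" b "norm x" c]
  by (meson norm_ge_zero order_trans)

text \<open>Throughout, \<open>\<phi>\<close> is the coordinate functional of the rank-one projection \<open>P\<close> with respect to
  its eigenvector \<open>v\<close>.\<close>

context
  fixes D :: "'a::{banach,complex_normed_vector} set" and A \<mu> P F v \<phi>
  assumes lin: "complex_linear_on D A" and data: "simple_pole_data D A \<mu> P F"
    and v: "v \<noteq> 0" "P v = v" and \<phi>: "\<And>x. P x = \<phi> x *\<^sub>C v"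
begin

lemma functional_eqI: "P x = c *\<^sub>C v \<Longrightarrow> \<phi> x = c"
proof -
  assume "P x = c *\<^sub>C v"
  then have "(\<phi> x - c) *\<^sub>C v = 0" by (simp add: scaleC.diff_left flip: \<phi>)
  then show ?thesis using v(1) by simp
qed

lemma functional_simps:
  "\<phi> (x + y) = \<phi> x + \<phi> y" "\<phi> (x - y) = \<phi> x - \<phi> y" "\<phi> (c *\<^sub>C x) = c * \<phi> x"
  "\<phi> v = 1" "\<phi> (F y) = 0"
proof -
  show "\<phi> (x + y) = \<phi> x + \<phi> y"
    by (rule functional_eqI) (simp add: blinfun.add_right \<phi> scaleC_add_left)
  show "\<phi> (x - y) = \<phi> x - \<phi> y"
    by (rule functional_eqI) (simp add: blinfun.diff_right \<phi> scaleC.diff_left)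
  show "\<phi> (c *\<^sub>C x) = c * \<phi> x"
    using complex_homogeneousD[OF simple_pole_hom(1)[OF lin data], of c x]
    by (intro functional_eqI) (simp add: \<phi> scaleC_scaleC)
  show "\<phi> v = 1" by (rule functional_eqI) (simp add: v)
  show "\<phi> (F y) = 0" by (rule functional_eqI) (simp add: simple_pole_PS[OF lin data])
qed

lemma functional_bound: "cmod (\<phi> x) \<le> norm P / norm v * norm x"
proof -
  have "cmod (\<phi> x) * norm v = norm (P x)" by (simp add: \<phi> norm_scaleC)
  also have "\<dots> \<le> norm P * norm x" by (rule norm_blinfun)
  finally show ?thesis using v(1) by (simp add: field_simps)
qed

text \<open>Write \<open>\<nu> - C = (\<mu> - A) + N\<close> with \<open>N\<close> small, and let \<open>L\<close> and \<open>L'\<close> be the inverses of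
  \<open>I + F N\<close> and \<open>I + N F\<close>. Then \<open>w = L v\<close> satisfies \<open>(\<nu> - C) w = \<phi> (N w) v\<close>, so it is an eigenvector
  exactly when the scalar equation \<open>\<phi> (N w) = 0\<close> holds; in this case \<open>\<psi> = \<phi> \<circ> L'\<close> is a left
  eigenvector. The operator \<open>T = F L' = L F\<close> is an inverse of \<open>\<nu> - C\<close> up to rank-one errors, namely
  \<open>(\<nu> - C) T y = y - \<psi> y v\<close> and \<open>T (\<nu> - C) x = x - \<phi> x w\<close>. If \<open>c = \<psi> w\<close> is nonzero, then
  \<open>x \<mapsto> \<psi> x w / c\<close> is the spectral projection, and compressing \<open>T\<close> to its kernel removes the
  errors and yields the reduced resolvent.\<close>

lemma perturbed_simple_pole_data:
  fixes N L L' :: "'a \<Rightarrow>\<^sub>L 'a"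
  assumes hom: "complex_homogeneous N" "complex_homogeneous L" "complex_homogeneous L'"
    and C: "\<And>x. \<nu> *\<^sub>C x - C x = (\<mu> *\<^sub>C x - A x) + N x"
    and L: "\<And>x. L x + F (N (L x)) = x" "\<And>x. L (x + F (N x)) = x"
    and L': "\<And>x. L' x + N (F (L' x)) = x" "\<And>x. L' (x + N (F x)) = x"
    and zero: "\<phi> (N (L v)) = 0" and c: "c = \<phi> (L' (L v))" "c \<noteq> 0"
    and P': "P' = inverse c *\<^sub>C (L o\<^sub>L P o\<^sub>L L')"
    and S': "S' = (id_blinfun - P') o\<^sub>L (F o\<^sub>L L') o\<^sub>L (id_blinfun - P')"
  shows "simple_pole_data D C \<nu> P' S'"
    and "L v \<noteq> 0" and "range (blinfun_apply P') = {c *\<^sub>C L v | c. True}"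
proof -
  note D = complex_linear_onD[OF lin]
  note base = simple_pole_P[OF lin data] simple_pole_S[OF lin data]
  note hom_simps = complex_homogeneousD[OF hom(1)] complex_homogeneousD[OF hom(2)]
    complex_homogeneousD[OF hom(3)] complex_homogeneousD[OF simple_pole_hom(1)[OF lin data]]
    complex_homogeneousD[OF simple_pole_hom(2)[OF lin data]]
  define w where "w = L v"
  define \<psi> where "\<psi> x = \<phi> (L' x)" for x
  define M where "M x = (\<mu> *\<^sub>C x - A x) + N x" for x
  have M_D: "M (x + y) = M x + M y" "M (c *\<^sub>C x) = c *\<^sub>C M x" if "x \<in> D" "y \<in> D" for x y c
    using that by (simp_all add: M_def D blinfun.add_right hom_simps scaleC_simps algebra_simps)
  have M_diff: "M (x - y) = M x - M y" if "x \<in> D" "y \<in> D" for x y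
    using M_D(1)[of x "(-1) *\<^sub>C y"] M_D(2)[of y y "-1"] that D(3)[of y "-1"] by simp
  have D_diff: "x - y \<in> D" if "x \<in> D" "y \<in> D" for x y
    using D(1)[of x "(-1) *\<^sub>C y"] that D(3)[of y "-1"] by simp
  have v_D: "v \<in> D" and Mv: "M v = N v"
    using base(1,2)[of v] v(2) by (simp_all add: M_def)
  have MF: "F y \<in> D" "M (F y) = (y - P y) + N (F y)" for y
    by (simp_all add: M_def base)
  have w_eq: "w = v - F (N w)" using L(1)[of v] unfolding w_def by (metis add_diff_cancel_right')
  have w_D: "w \<in> D" by (subst w_eq) (intro D_diff v_D MF)
  have \<phi>w: "\<phi> w = 1" by (subst w_eq) (simp add: functional_simps)
  have w_nz: "w \<noteq> 0" using \<phi>w functional_simps(3)[of 0 0] by auto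
  have Mw: "M w = 0"
  proof -
    have "M w = M v - M (F (N w))" by (subst w_eq) (rule M_diff[OF v_D MF(1)])
    also have "\<dots> = N v - N (w + F (N w)) + P (N w)" by (simp add: Mv MF(2) blinfun.add_right)
    also have "w + F (N w) = v" using L(1)[of v] by (simp only: w_def)
    finally show ?thesis using zero by (simp add: \<phi> w_def)
  qed
  have LF: "L (F y) = F (L' y)" for y
  proof -
    have "F y = F (L' y) + F (N (F (L' y)))"
      using arg_cong[OF L'(1)[of y], of F] by (simp add: blinfun.add_right)
    then show ?thesis using L(2)[of "F (L' y)"] by simp
  qed
  have \<psi>_simps: "\<psi> (x + y) = \<psi> x + \<psi> y" "\<psi> (x - y) = \<psi> x - \<psi> y" "\<psi> (a *\<^sub>C x) = a * \<psi> x" for x y a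
    by (simp_all add: \<psi>_def blinfun.add_right blinfun.diff_right hom_simps functional_simps)
  have P'_apply: "P' x = (\<psi> x / c) *\<^sub>C w" for x
    by (simp add: P' scaleC_blinfun.rep_eq \<phi> \<psi>_def hom_simps scaleC_scaleC divide_inverse w_def mult.commute)
  have \<psi>w: "\<psi> w = c" by (simp add: \<psi>_def w_def c(1))
  have P'w: "P' w = w" using c(2) by (simp add: P'_apply \<psi>w)
  have \<psi>P': "\<psi> (P' x) = \<psi> x" for x using c(2) by (simp add: P'_apply \<psi>_simps \<psi>w)
  have P'P': "P' (P' x) = P' x" for x by (simp add: P'_apply[of "P' x"] \<psi>P' flip: P'_apply)
  have P'_D: "P' x \<in> D" "M (P' x) = 0" for x
    using D(3)[OF w_D] M_D(2)[OF w_D w_D] by (simp_all add: P'_apply Mw)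
  have MT: "F (L' y) \<in> D" "M (F (L' y)) = y - \<psi> y *\<^sub>C v" for y
  proof -
    have "M (F (L' y)) = (L' y + N (F (L' y))) - P (L' y)" by (simp add: MF(2))
    then show "M (F (L' y)) = y - \<psi> y *\<^sub>C v" by (simp add: L'(1) \<phi> \<psi>_def)
  qed (rule MF)
  have TM: "F (L' (M x)) = x - \<phi> x *\<^sub>C w" if x: "x \<in> D" for x
  proof -
    have "F (M x) = (x + F (N x)) - P x"
      using simple_pole_S_left[OF lin data x] by (simp add: M_def blinfun.add_right)
    then have "L (F (M x)) = L (x + F (N x)) - L (P x)" by (simp add: blinfun.diff_right)
    then show ?thesis by (simp add: LF L(2) \<phi> hom_simps w_def)
  qed
  have \<psi>M: "\<psi> (M x) = 0" if x: "x \<in> D" for x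
  proof -
    have "L' (M x) = M x - N (F (L' (M x)))" using L'(1)[of "M x"] by (metis add_diff_cancel_right')
    then have "\<psi> (M x) = \<phi> (M x) - \<phi> (N (x - \<phi> x *\<^sub>C w))"
      by (simp only: \<psi>_def functional_simps TM[OF x])
    moreover have "\<phi> (\<mu> *\<^sub>C x - A x) = 0"
      by (rule functional_eqI) (simp add: simple_pole_P_left[OF lin data x])
    ultimately show ?thesis
      using zero by (simp add: M_def functional_simps blinfun.diff_right hom_simps w_def)
  qed
  have P'M: "P' (M x) = 0" if "x \<in> D" for x using \<psi>M[OF that] by (simp add: P'_apply)
  have S'_apply: "S' y = F (L' (y - P' y)) - P' (F (L' (y - P' y)))" for y
    by (simp add: S' blinfun.bilinear_simps)
  have hom': "complex_homogeneous P'" "complex_homogeneous S'"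
    unfolding S' P' by (intro complex_homogeneous_ops hom simple_pole_hom[OF lin data])+
  have M_eq: "\<nu> *\<^sub>C x - C x = M x" for x by (simp add: C M_def)
  show "simple_pole_data D C \<nu> P' S'"
    unfolding simple_pole_data_def M_eq
  proof (intro conjI allI ballI hom')
    fix x y
    show "P' x \<in> D" by (rule P'_D)
    show "C (P' x) = \<nu> *\<^sub>C P' x" using M_eq[of "P' x"] P'_D(2)[of x] by simp
    show "S' y \<in> D" unfolding S'_apply by (intro D_diff MT P'_D)
    show "M (S' y) = y - P' y"
      unfolding S'_apply by (simp add: M_diff MT P'_D \<psi>_simps \<psi>P')
    show "P' (S' y) = 0" by (simp add: S'_apply blinfun.diff_right P'P')
  next
    fix x assume x: "x \<in> D"
    have "S' (M x) = (x - \<phi> x *\<^sub>C w) - P' (x - \<phi> x *\<^sub>C w)" by (simp add: S'_apply P'M TM x)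
    also have "\<dots> = x - P' x"
      by (simp add: blinfun.diff_right complex_homogeneousD[OF hom'(1)] P'w)
    finally show "S' (M x) = x - P' x" .
  qed
  show "L v \<noteq> 0" using w_nz by (simp add: w_def)
  have "\<exists>x. a *\<^sub>C w = P' x" for a
    using complex_homogeneousD[OF hom'(1), of a w] by (intro exI[of _ "a *\<^sub>C w"]) (simp add: P'w)
  then show "range (blinfun_apply P') = {c *\<^sub>C L v | c. True}"
    unfolding w_def[symmetric] by (auto simp: P'_apply)
qed

end

lemma neumann_pair:
  fixes F N :: "'a::{banach,complex_normed_vector} \<Rightarrow>\<^sub>L 'a"
  assumes hom: "complex_homogeneous F" "complex_homogeneous N" and small: "norm F * norm N \<le> 1/2"
  obtains L :: "'a \<Rightarrow>\<^sub>L 'a" where "complex_homogeneous L" "norm L \<le> 2"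
    and "\<And>x. L x + F (N (L x)) = x" "\<And>x. L (x + F (N x)) = x"
proof -
  let ?X = "- (F o\<^sub>L N)"
  have X: "norm ?X \<le> 1/2" using norm_blinfun_compose[of F N] small by simp
  then have "norm ?X < 1" by simp
  then obtain L :: "'a \<Rightarrow>\<^sub>L 'a" where L: "\<And>x. L x = x + ?X (L x)" "\<And>x. L (x - ?X x) = x" "norm L \<le> 1 / (1 - norm ?X)"
    using neumann_series by metis
  show thesis
  proof
    have "complex_homogeneous ?X"
      using hom by (simp add: complex_homogeneous_def blinfun.minus_left scaleC.minus_right)
    then show "complex_homogeneous L" by (rule complex_homogeneous_neumann[OF _ L(1,2)])
    have "1 / (1 - norm ?X) \<le> 2" using X by (simp add: field_simps)
    then show "norm L \<le> 2" using L(3) by (rule order_trans[rotated])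
    show "L (x + F (N x)) = x" for x using L(2)[of x] by (simp add: blinfun.minus_left)
    have X_apply: "?X (L x) = - F (N (L x))" for x by (simp add: blinfun.minus_left)
    show "L x + F (N (L x)) = x" for x
      using L(1)[of x] unfolding X_apply by (metis add.assoc add.right_neutral left_minus)
  qed
qed

text \<open>With \<open>\<nu> = \<mu> + t\<close> and \<open>N = t - B\<close>, the scalar equation of the previous lemma is the
  fixed-point equation \<open>t = \<phi> (B (L t v))\<close>, because \<open>\<phi> (L t v) = 1\<close>. For small \<open>B\<close> its
  right-hand side is a contraction of a small disc, so Banach's theorem supplies the perturbed
  eigenvalue. The estimates are uniform in \<open>B\<close>.\<close>

lemma simple_pole_perturbation:
  fixes D :: "'a::{banach,complex_normed_vector} set"
  assumes lin: "complex_linear_on D A" and data: "simple_pole_data D A \<mu> P F"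
    and v: "v \<noteq> 0" "P v = v" and rank: "\<And>x. \<exists>c. P x = c *\<^sub>C v"
  obtains K \<eta> where "\<eta> > 0"
    and "\<And>B. complex_homogeneous B \<Longrightarrow> norm B < \<eta> \<Longrightarrow>
      \<exists>\<nu> P' S' w. simple_pole_data D (\<lambda>x. A x + B x) \<nu> P' S' \<and> w \<noteq> 0 \<and>
        range (blinfun_apply P') = {c *\<^sub>C w | c. True} \<and>
        cmod (\<nu> - \<mu>) \<le> K * norm B \<and> norm S' \<le> K"
proof -
  obtain \<phi> where \<phi>: "\<And>x. P x = \<phi> x *\<^sub>C v" using rank by metis
  note hom_F = simple_pole_hom(2)[OF lin data]
  note \<phi>_simps = functional_simps[OF lin data v \<phi>]
  define a where "a = norm F"
  define b where "b = norm v"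
  define q where "q = norm P / norm v"
  \<comment> \<open>\<open>\<kappa>\<close> bounds \<open>norm (t - B)\<close>: it gives \<open>norm (L t) \<le> 2\<close> and keeps \<open>\<psi> w\<close> at distance at most
    \<open>1/2\<close> from \<open>1\<close>. The bound \<open>\<eta>\<close> on \<open>norm B\<close> makes the fixed-point map a self-map and a
    contraction of the disc of radius \<open>\<kappa>/2\<close>.\<close>
  define s where "s = 2 * a + 8 * (q * a * b) + 1"
  define d where "d = 2 + 4 * (q * b) + 8 * (q * a * b)"
  define \<kappa> where "\<kappa> = 1 / s"
  define \<eta> where "\<eta> = \<kappa> / d"
  define K where "K = max (2 * (q * b)) ((1 + 8 * norm P) * (a * 2) * (1 + 8 * norm P))"
  have nonneg: "0 \<le> a" "0 \<le> b" "0 \<le> q" "0 \<le> q * b" "0 \<le> q * a * b"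
    by (simp_all add: a_def b_def q_def)
  have \<phi>_bound: "cmod (\<phi> x) \<le> q * norm x" for x
    unfolding q_def by (rule functional_bound[OF lin data v \<phi>])
  have s: "1 \<le> s" "2 * a \<le> s" "8 * (q * a * b) \<le> s" using nonneg by (simp_all add: s_def)
  then have \<kappa>: "0 < \<kappa>" "\<kappa> \<le> 1" "a * \<kappa> \<le> 1/2" "8 * (q * a * b) * \<kappa> \<le> 1"
    by (simp_all add: \<kappa>_def divide_le_eq)
  have d: "2 \<le> d" "4 * (q * b) \<le> d" "8 * (q * a * b) \<le> d" using nonneg by (simp_all add: d_def)
  have shrink: "x * \<eta> \<le> \<kappa>" if "x \<le> d" for x
    using mult_right_mono[OF that, of \<kappa>] \<kappa>(1) d(1) by (simp add: \<eta>_def divide_le_eq mult.commute)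
  have "0 < \<eta>" using \<kappa>(1) d(1) by (simp add: \<eta>_def)
  then have \<eta>: "0 < \<eta>" "\<eta> \<le> \<kappa> / 2" "4 * (q * b) * \<eta> \<le> \<kappa>" "8 * (q * a * b) * \<eta> \<le> \<kappa>"
    using shrink[OF d(1)] shrink[OF d(2)] shrink[OF d(3)] by simp_all
  have main: "\<exists>\<nu> P' S' w. simple_pole_data D (\<lambda>x. A x + B x) \<nu> P' S' \<and> w \<noteq> 0 \<and>
        range (blinfun_apply P') = {c *\<^sub>C w | c. True} \<and>
        cmod (\<nu> - \<mu>) \<le> K * norm B \<and> norm S' \<le> K"
    if hom_B: "complex_homogeneous B" and B: "norm B < \<eta>" for B
  proof -
    define N where "N t = t *\<^sub>C id_blinfun - B" for t
    have N_apply: "N t x = t *\<^sub>C x - B x" for t x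
      by (simp add: N_def blinfun.diff_left scaleC_blinfun.rep_eq)
    have N_hom: "complex_homogeneous (N t)" for t
      unfolding N_def by (intro complex_homogeneous_ops hom_B)
    have N_norm: "norm (N t) \<le> \<kappa>" if "cmod t \<le> \<kappa> / 2" for t
    proof -
      have "norm (N t) \<le> norm (t *\<^sub>C (id_blinfun :: 'a \<Rightarrow>\<^sub>L 'a)) + norm B"
        unfolding N_def by (rule norm_triangle_ineq4)
      also have "norm (t *\<^sub>C (id_blinfun :: 'a \<Rightarrow>\<^sub>L 'a)) \<le> cmod t * 1"
        unfolding norm_scaleC by (intro mult_left_mono norm_blinfun_id_le) simp
      finally show ?thesis using that B \<eta>(2) by simp
    qed
    have FN_small: "norm F * norm (N t) \<le> 1/2" "norm (N t) * norm F \<le> 1/2" if "cmod t \<le> \<kappa> / 2" for t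
      using mult_left_mono[OF N_norm[OF that] nonneg(1)] \<kappa>(3) by (simp_all add: a_def mult.commute)
    define T where "T = cball (0 :: complex) (\<kappa> / 2)"
    have T: "t \<in> T \<longleftrightarrow> cmod t \<le> \<kappa> / 2" for t by (simp add: T_def)
    have "\<exists>L. complex_homogeneous L \<and> norm L \<le> 2 \<and> (\<forall>x. L x + F (N t (L x)) = x) \<and>
        (\<forall>x. L (x + F (N t x)) = x)" if "t \<in> T" for t
      using neumann_pair[OF hom_F N_hom FN_small(1)] that unfolding T by metis
    then obtain L where L: "\<And>t. t \<in> T \<Longrightarrow> complex_homogeneous (L t)" "\<And>t. t \<in> T \<Longrightarrow> norm (L t) \<le> 2"
        "\<And>t x. t \<in> T \<Longrightarrow> L t x + F (N t (L t x)) = x" "\<And>t x. t \<in> T \<Longrightarrow> L t (x + F (N t x)) = x"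
      by metis
    have Lv: "norm (L t v) \<le> 2 * b" if "t \<in> T" for t
      unfolding b_def by (rule norm_blinfun_le[OF L(2)[OF that] order_refl])
    define g where "g t = \<phi> (B (L t v))" for t
    have g_bound: "cmod (g t) \<le> 2 * (q * b) * norm B" if "t \<in> T" for t
    proof -
      have "cmod (g t) \<le> q * norm (B (L t v))" unfolding g_def by (rule \<phi>_bound)
      also have "\<dots> \<le> q * (norm B * (2 * b))"
        by (intro mult_left_mono norm_blinfun_le[of B] order_refl Lv that nonneg)
      finally show ?thesis by (simp add: mult_ac)
    qed
    have g_T: "g t \<in> T" if "t \<in> T" for t
    proof -
      have "2 * (q * b) * norm B \<le> 2 * (q * b) * \<eta>" using B nonneg by (intro mult_left_mono) auto
      then show ?thesis unfolding T using g_bound[OF that] \<eta>(3) by simp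
    qed
    have g_lipschitz: "dist (g t) (g s) \<le> 1/2 * dist t s" if ts: "t \<in> T" "s \<in> T" for t s
    proof -
      define d where "d = L t v - L s v"
      have "d + F (N t d) = (L t v + F (N t (L t v))) - (L s v + F (N s (L s v))) - F (N t (L s v) - N s (L s v))"
        by (simp add: d_def blinfun.bilinear_simps)
      also have "N t (L s v) - N s (L s v) = (t - s) *\<^sub>C L s v" by (simp add: N_apply scaleC.diff_left)
      finally have d: "d + F (N t d) = - F ((t - s) *\<^sub>C L s v)" using L(3) ts by simp
      have "norm (F ((t - s) *\<^sub>C L s v)) \<le> a * (cmod (t - s) * (2 * b))"
        unfolding a_def
        by (intro norm_blinfun_le[of F] order_refl) (simp add: norm_scaleC mult_left_mono Lv ts)
      then have "norm (d + F (N t d)) \<le> a * (cmod (t - s) * (2 * b))" by (simp add: d)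
      then have "norm (L t (d + F (N t d))) \<le> 2 * (a * (cmod (t - s) * (2 * b)))"
        by (rule norm_blinfun_le[OF L(2)[OF ts(1)]])
      then have d_norm: "norm d \<le> 4 * (a * b) * cmod (t - s)"
        by (simp add: L(4)[OF ts(1)] mult_ac)
      have "g t - g s = \<phi> (B d)" by (simp add: g_def d_def blinfun.diff_right \<phi>_simps)
      then have "cmod (g t - g s) \<le> q * norm (B d)" using \<phi>_bound by simp
      also have "\<dots> \<le> q * (norm B * (4 * (a * b) * cmod (t - s)))"
        by (intro mult_left_mono norm_blinfun_le[of B] order_refl d_norm nonneg)
      also have "\<dots> = (4 * (q * a * b) * norm B) * cmod (t - s)" by (simp add: mult_ac)
      also have "\<dots> \<le> 1/2 * cmod (t - s)"
      proof (intro mult_right_mono)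
        have "4 * (q * a * b) * norm B \<le> 4 * (q * a * b) * \<eta>" using B nonneg by (intro mult_left_mono) auto
        then show "4 * (q * a * b) * norm B \<le> 1/2" using \<eta>(4) \<kappa>(2) by simp
      qed simp
      finally show ?thesis by (simp add: dist_norm)
    qed
    have "\<exists>!t\<in>T. g t = t"
    proof (rule Banach_fix)
      show "complete T" "T \<noteq> {}" using \<kappa>(1) by (auto simp: T_def complete_eq_closed)
      show "g ` T \<subseteq> T" using g_T by blast
      show "dist (g t) (g s) \<le> 1/2 * dist t s" if "t \<in> T" "s \<in> T" for t s
        by (rule g_lipschitz[OF that])
    qed simp_all
    then obtain t where t: "t \<in> T" "g t = t" by blast
    let ?w = "L t v"
    obtain L' where L': "complex_homogeneous L'" "norm L' \<le> 2"
        "\<And>x. L' x + N t (F (L' x)) = x" "\<And>x. L' (x + N t (F x)) = x"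
      using neumann_pair[OF N_hom hom_F FN_small(2)] t(1) unfolding T by metis
    have "?w = v - F (N t ?w)" using L(3)[OF t(1), of v] by (metis add_diff_cancel_right')
    then have \<phi>w: "\<phi> ?w = 1" using \<phi>_simps(2,4,5) by (metis diff_zero)
    have zero: "\<phi> (N t ?w) = 0" using t(2) by (simp add: N_apply \<phi>_simps \<phi>w g_def)
    define c where "c = \<phi> (L' ?w)"
    have c: "cmod c \<ge> 1/2"
    proof -
      have "L' ?w = ?w - N t (F (L' ?w))" using L'(3)[of ?w] by (metis add_diff_cancel_right')
      then have "c = 1 - \<phi> (N t (F (L' ?w)))" unfolding c_def using \<phi>_simps(2) \<phi>w by metis
      moreover have "cmod (\<phi> (N t (F (L' ?w)))) \<le> q * (\<kappa> * (a * (2 * (2 * b))))"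
      proof -
        have "norm (L' ?w) \<le> 2 * (2 * b)" by (rule norm_blinfun_le[OF L'(2) Lv[OF t(1)]])
        then have "norm (F (L' ?w)) \<le> a * (2 * (2 * b))"
          unfolding a_def by (rule norm_blinfun_le[OF order_refl])
        then have "norm (N t (F (L' ?w))) \<le> \<kappa> * (a * (2 * (2 * b)))"
          by (rule norm_blinfun_le[OF N_norm[OF t(1)[unfolded T]]])
        then have "q * norm (N t (F (L' ?w))) \<le> q * (\<kappa> * (a * (2 * (2 * b))))"
          by (rule mult_left_mono[OF _ nonneg(3)])
        then show ?thesis by (rule order_trans[OF \<phi>_bound])
      qed
      moreover have "q * (\<kappa> * (a * (2 * (2 * b)))) \<le> 1/2" using \<kappa>(4) by (simp add: mult_ac)
      ultimately show ?thesis using norm_triangle_ineq2[of 1 "\<phi> (N t (F (L' ?w)))"] by simp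
    qed
    define P' where "P' = inverse c *\<^sub>C (L t o\<^sub>L P o\<^sub>L L')"
    define S' where "S' = (id_blinfun - P') o\<^sub>L (F o\<^sub>L L') o\<^sub>L (id_blinfun - P')"
    have C: "(\<mu> + t) *\<^sub>C x - (A x + B x) = (\<mu> *\<^sub>C x - A x) + N t x" for x
      by (simp add: N_apply scaleC_add_left)
    have "c \<noteq> 0" using c by auto
    note data' = perturbed_simple_pole_data[OF lin data v \<phi> N_hom L(1)[OF t(1)] L'(1) C
        L(3,4)[OF t(1)] L'(3,4) zero c_def \<open>c \<noteq> 0\<close> P'_def S'_def]
    have P'_norm: "norm P' \<le> 8 * norm P"
    proof -
      have "norm P' = inverse (cmod c) * norm (L t o\<^sub>L P o\<^sub>L L')" by (simp add: P'_def norm_scaleC norm_inverse)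
      also have "\<dots> \<le> 2 * (2 * norm P * 2)"
      proof (intro mult_mono)
        show "inverse (cmod c) \<le> 2" using le_imp_inverse_le[OF c] by simp
        have "norm (L t o\<^sub>L P) \<le> 2 * norm P"
          using norm_blinfun_compose[of "L t" P] mult_right_mono[OF L(2)[OF t(1)] norm_ge_zero[of P]] by simp
        then show "norm (L t o\<^sub>L P o\<^sub>L L') \<le> 2 * norm P * 2"
          using norm_blinfun_compose[of "L t o\<^sub>L P" L'] L'(2) mult_mono[of "norm (L t o\<^sub>L P)" "2 * norm P" "norm L'" 2]
          by (meson mult_nonneg_nonneg norm_ge_zero order_trans zero_le_numeral)
      qed auto
      finally show ?thesis by simp
    qed
    have E: "norm (id_blinfun - P') \<le> 1 + 8 * norm P"
      using norm_triangle_ineq4[of id_blinfun P'] P'_norm norm_blinfun_id_le[where 'a = 'a] by linarith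
    have FL': "norm (F o\<^sub>L L') \<le> a * 2"
      using norm_blinfun_compose[of F L'] mult_left_mono[OF L'(2) nonneg(1)] by (simp add: a_def)
    have "norm S' \<le> norm ((id_blinfun - P') o\<^sub>L (F o\<^sub>L L')) * norm (id_blinfun - P')"
      unfolding S'_def by (rule norm_blinfun_compose)
    also have "\<dots> \<le> (norm (id_blinfun - P') * norm (F o\<^sub>L L')) * norm (id_blinfun - P')"
      by (intro mult_right_mono norm_blinfun_compose) simp
    also have "\<dots> \<le> (1 + 8 * norm P) * (a * 2) * (1 + 8 * norm P)"
      using nonneg by (intro mult_mono E FL') auto
    finally have S'_norm: "norm S' \<le> K" by (simp add: K_def)
    have "cmod ((\<mu> + t) - \<mu>) \<le> 2 * (q * b) * norm B" using g_bound[OF t(1)] t(2) by simp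
    also have "\<dots> \<le> K * norm B" by (intro mult_right_mono) (simp_all add: K_def)
    finally show ?thesis using data' S'_norm by blast
  qed
  show thesis by (rule that[OF \<eta>(1) main])
qed

section \<open>Persistence of strong positivity\<close>

text \<open>Moving the spectral parameter from \<open>z + s\<close> down to \<open>z\<close> amounts to the positive perturbation
  \<open>s I\<close> of the operator.\<close>

lemma inverts_shift:
  assumes "inverts D (\<lambda>x. C x + (s *\<^sub>R id_blinfun) x) (complex_of_real (z + s)) R"
  shows "inverts D C (complex_of_real z) R"
  using assms unfolding inverts_def scaleC_of_real
  by (simp add: scaleR_add_left blinfun.scaleR_left algebra_simps)

text \<open>Descend from \<open>\<beta>\<close> to \<open>z\<close> in finitely many steps of length at most \<open>h\<close>. Each step is a
  positive perturbation by a multiple of the identity, and the uniform bound on the resolvent keeps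
  all of them inside the range of the Neumann series.\<close>

lemma positive_resolvent_antimono:
  fixes D :: "'a::banach_lattice complexification set"
  assumes rho: "\<And>z. \<alpha> \<le> z \<Longrightarrow> z \<le> \<beta> \<Longrightarrow> complex_of_real z \<in> resolvent_set D C"
    and bound: "\<And>z. \<alpha> \<le> z \<Longrightarrow> z \<le> \<beta> \<Longrightarrow> norm (resolvent D C (complex_of_real z)) \<le> M"
    and pos: "positive_operator (resolvent D C (complex_of_real \<beta>))"
    and z: "\<alpha> \<le> z" "z \<le> \<beta>" and f: "0 \<le> f"
  shows "resolvent D C (complex_of_real \<beta>) f \<le> resolvent D C (complex_of_real z) f"
proof -
  have M: "0 \<le> M" using order_trans[OF norm_ge_zero bound[OF z]] .
  define h where "h = 1 / (M + 1)"
  have h: "0 < h" "h * M < 1" using M by (simp_all add: h_def field_simps)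
  have "\<forall>f\<ge>0. resolvent D C (complex_of_real \<beta>) f \<le> resolvent D C (complex_of_real z) f"
    if "\<beta> - z \<le> real n * h" "\<alpha> \<le> z" "z \<le> \<beta>" for n z
    using that
  proof (induction n arbitrary: z)
    case 0
    then show ?case by simp
  next
    case (Suc n)
    define s where "s = min h (\<beta> - z)"
    have s: "0 \<le> s" "s \<le> h" "z + s \<le> \<beta>" "\<alpha> \<le> z + s" "\<beta> - (z + s) \<le> real n * h"
      using Suc.prems h(1) by (auto simp: s_def min_def algebra_simps)
    let ?R = "resolvent D C (complex_of_real (z + s))"
    let ?X = "s *\<^sub>R id_blinfun :: 'a complexification \<Rightarrow>\<^sub>L 'a complexification"
    note IH = Suc.IH[OF s(5,4,3)]
    have R_pos: "positive_operator ?R"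
      unfolding positive_operator_def
      using IH positive_operatorD[OF pos] by (meson order_trans)
    have X_pos: "positive_operator ?X"
      using s(1) by (simp add: positive_operator_def blinfun.scaleR_left scaleR_nonneg_nonneg)
    have "norm ?X \<le> h"
      using s(1,2) mult_left_mono[OF norm_blinfun_id_le[where 'a = "'a complexification"] s(1)] by simp
    then have "norm ?X * norm ?R \<le> h * M"
      using h(1) bound[OF s(4,3)] by (intro mult_mono) auto
    then have small: "norm ?X * norm ?R < 1" using h(2) by simp
    note step = resolvent_positive_perturbation[OF rho[OF s(4,3)] R_pos X_pos small]
    have "resolvent D (\<lambda>x. C x + ?X x) (complex_of_real (z + s)) = resolvent D C (complex_of_real z)"
      using inverts_imp_resolvent(2)[OF inverts_shift[OF inverts_resolvent[OF step(1)]]] ..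
    then show ?case using step(2) IH by (metis order_trans)
  qed
  moreover obtain n where "\<beta> - z \<le> real n * h"
    using reals_Archimedean3[OF h(1)] less_imp_le by blast
  ultimately show ?thesis using z f by blast
qed

lemma eigenvalue_in_spectrum:
  assumes "w \<in> D" "w \<noteq> 0" "C w = \<mu> *\<^sub>C w" shows "\<mu> \<in> spectrum D C"
proof (rule ccontr)
  assume "\<mu> \<notin> spectrum D C"
  then have "inverts D C \<mu> (resolvent D C \<mu>)" by (intro inverts_resolvent) (simp add: spectrum_def)
  then have "resolvent D C \<mu> (\<mu> *\<^sub>C w - C w) = w" using assms(1) by (simp add: inverts_def)
  then show False using assms by simp
qed

section \<open>The perturbation theorem\<close>

theorem theorem3p1:
  fixes D :: "('a::banach_lattice) complexification set"
    and A :: "'a complexification \<Rightarrow> 'a complexification"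
    and u :: "'a complexification"
    and \<mu>\<^sub>0 :: real
  assumes "complex_linear_on D A"
    and "closed_operator D A"
    and "densely_defined D"
    and "real_operator D A"
    and "complex_of_real \<mu>\<^sub>0 \<in> spectrum D A"
    and "pole_of_resolvent D A (complex_of_real \<mu>\<^sub>0)"
    and "quasi_interior_point u"
    and "resolvent_unif_ev_strongly_positive D A u \<mu>\<^sub>0"
  shows "\<exists>r\<^sub>0>0. \<forall>r. 0 < r \<and> r < r\<^sub>0 \<longrightarrow>
    (\<exists>\<epsilon>>0. \<forall>B :: 'a complexification \<Rightarrow>\<^sub>L 'a complexification.
       complex_linear_on UNIV (blinfun_apply B) \<and> positive_operator B \<and> norm B < \<epsilon> \<longrightarrow>
       (\<exists>\<mu>\<^sub>B::complex.
          spectrum D (\<lambda>x. A x + B x) \<inter> ball (complex_of_real \<mu>\<^sub>0) r = {\<mu>\<^sub>B} \<and>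
          \<mu>\<^sub>B \<in> \<real> \<and>
          pole_of_resolvent D (\<lambda>x. A x + B x) \<mu>\<^sub>B \<and>
          algebraically_simple_eigenvalue D (\<lambda>x. A x + B x) \<mu>\<^sub>B \<and>
          resolvent_unif_ev_strongly_positive D (\<lambda>x. A x + B x) u (Re \<mu>\<^sub>B)))"
proof -
  note lin = assms(1) and real = assms(4)
  obtain P F v where data: "simple_pole_data D A (complex_of_real \<mu>\<^sub>0) P F"
      and v: "v \<noteq> 0" "P v = v" and rank: "\<And>x. \<exists>c. P x = c *\<^sub>C v"
    by (rule dominant_pole[OF lin assms(2,6,7,8)]) (rule that)
  obtain K \<eta> where \<eta>: "\<eta> > 0" and perturb: "\<And>B. complex_homogeneous B \<Longrightarrow> norm B < \<eta> \<Longrightarrow>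
      \<exists>\<nu> P' S' w. simple_pole_data D (\<lambda>x. A x + B x) \<nu> P' S' \<and> w \<noteq> 0 \<and>
        range (blinfun_apply P') = {c *\<^sub>C w | c. True} \<and>
        cmod (\<nu> - complex_of_real \<mu>\<^sub>0) \<le> K * norm B \<and> norm S' \<le> K"
    by (rule simple_pole_perturbation[OF lin data v rank]) (rule that)
  obtain \<mu>\<^sub>1 where \<mu>\<^sub>1: "\<mu>\<^sub>1 > \<mu>\<^sub>0" and rho_A: "\<And>z. \<mu>\<^sub>0 < z \<Longrightarrow> z \<le> \<mu>\<^sub>1 \<Longrightarrow> complex_of_real z \<in> resolvent_set D A"
    and strong_A: "\<And>z f. \<mu>\<^sub>0 < z \<Longrightarrow> z \<le> \<mu>\<^sub>1 \<Longrightarrow> 0 < f \<Longrightarrow>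
      strongly_positive u (resolvent D A (complex_of_real z) f)"
    using assms(8) unfolding resolvent_unif_ev_strongly_positive_def by (metis greaterThanAtMost_iff)
  have u0: "0 \<le> u" using assms(7) by (simp add: quasi_interior_point_def)
  \<comment> \<open>A positive version of \<open>K\<close>; it serves both to divide and to bound the reduced resolvents.\<close>
  define k where "k = max K 1"
  have k: "K \<le> k" "0 < k" by (simp_all add: k_def)
  define r\<^sub>0 where "r\<^sub>0 = min (1 / (2 * k)) (\<mu>\<^sub>1 - \<mu>\<^sub>0)"
  have "r\<^sub>0 > 0" using k(2) \<mu>\<^sub>1 by (simp add: r\<^sub>0_def)
  moreover have "\<exists>\<epsilon>>0. \<forall>B :: 'a complexification \<Rightarrow>\<^sub>L 'a complexification.
       complex_linear_on UNIV (blinfun_apply B) \<and> positive_operator B \<and> norm B < \<epsilon> \<longrightarrow>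
       (\<exists>\<mu>\<^sub>B::complex.
          spectrum D (\<lambda>x. A x + B x) \<inter> ball (complex_of_real \<mu>\<^sub>0) r = {\<mu>\<^sub>B} \<and>
          \<mu>\<^sub>B \<in> \<real> \<and>
          pole_of_resolvent D (\<lambda>x. A x + B x) \<mu>\<^sub>B \<and>
          algebraically_simple_eigenvalue D (\<lambda>x. A x + B x) \<mu>\<^sub>B \<and>
          resolvent_unif_ev_strongly_positive D (\<lambda>x. A x + B x) u (Re \<mu>\<^sub>B))"
    if r: "0 < r" "r < r\<^sub>0" for r
  proof -
    \<comment> \<open>The perturbed spectral value will lie within \<open>r/4\<close> of \<open>\<mu>\<^sub>0\<close>, hence below \<open>\<beta>\<close>, and the
      whole interval up to \<open>\<beta>\<close> stays inside the disc where it is the only spectral value.\<close>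
    define \<beta> where "\<beta> = \<mu>\<^sub>0 + r / 2"
    have \<beta>: "\<mu>\<^sub>0 < \<beta>" "\<beta> \<le> \<mu>\<^sub>1" using r by (simp_all add: \<beta>_def r\<^sub>0_def)
    have rk: "2 * r * k < 1" using r(2) k(2) by (simp add: r\<^sub>0_def field_simps)
    let ?R = "resolvent D A (complex_of_real \<beta>)"
    define \<epsilon> where "\<epsilon> = min \<eta> (min (r / (4 * k)) (1 / (norm ?R + 1)))"
    have "\<epsilon> > 0" using \<eta> r(1) k(2) by (simp add: \<epsilon>_def add_nonneg_pos)
    moreover have "\<exists>\<mu>\<^sub>B::complex.
          spectrum D (\<lambda>x. A x + B x) \<inter> ball (complex_of_real \<mu>\<^sub>0) r = {\<mu>\<^sub>B} \<and>
          \<mu>\<^sub>B \<in> \<real> \<and>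
          pole_of_resolvent D (\<lambda>x. A x + B x) \<mu>\<^sub>B \<and>
          algebraically_simple_eigenvalue D (\<lambda>x. A x + B x) \<mu>\<^sub>B \<and>
          resolvent_unif_ev_strongly_positive D (\<lambda>x. A x + B x) u (Re \<mu>\<^sub>B)"
      if B_lin: "complex_linear_on UNIV (blinfun_apply B)" and B_pos: "positive_operator B"
        and B_norm: "norm B < \<epsilon>" for B :: "'a complexification \<Rightarrow>\<^sub>L 'a complexification"
    proof -
      let ?C = "\<lambda>x. A x + B x"
      have B_hom: "complex_homogeneous B"
        using B_lin by (simp add: complex_linear_on_def complex_homogeneous_def)
      note lin' = complex_linear_on_add_blinfun[OF lin B_hom]
      have "norm B < \<eta>" using B_norm by (simp add: \<epsilon>_def)
      from perturb[OF B_hom this] obtain \<nu> P' S' w where data': "simple_pole_data D ?C \<nu> P' S'"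
          and w: "w \<noteq> 0" "range (blinfun_apply P') = {c *\<^sub>C w | c. True}"
          and \<nu>: "cmod (\<nu> - complex_of_real \<mu>\<^sub>0) \<le> K * norm B" and S': "norm S' \<le> K"
        by blast
      note near = resolvent_near_simple_pole[OF lin' data']
      have "K * norm B \<le> k * norm B" using k(1) by (intro mult_right_mono) simp_all
      also have "\<dots> < k * (r / (4 * k))" using B_norm k(2) by (intro mult_strict_left_mono) (simp_all add: \<epsilon>_def)
      also have "\<dots> = r / 4" using k(2) by simp
      finally have \<nu>_near: "cmod (\<nu> - complex_of_real \<mu>\<^sub>0) < r / 4" using \<nu> by simp
      have small: "cmod (z - \<nu>) * norm S' < 1" if "z \<in> ball (complex_of_real \<mu>\<^sub>0) r" for z
      proof -
        have "cmod (z - \<nu>) \<le> 2 * r"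
          using norm_triangle_ineq4[of "z - complex_of_real \<mu>\<^sub>0" "\<nu> - complex_of_real \<mu>\<^sub>0"] \<nu>_near that r(1)
          by (simp add: dist_norm norm_minus_commute)
        then have "cmod (z - \<nu>) * norm S' \<le> 2 * r * k"
          using S' k r(1) by (intro mult_mono) auto
        then show ?thesis using rk by simp
      qed
      have \<nu>_ball: "\<nu> \<in> ball (complex_of_real \<mu>\<^sub>0) r"
        using \<nu>_near r(1) by (simp add: dist_norm norm_minus_commute)
      obtain x\<^sub>0 where "P' x\<^sub>0 = w"
        using w(2) scaleC_one[of w] by (metis (mono_tags, lifting) mem_Collect_eq rangeE)
      then have \<nu>_spec: "\<nu> \<in> spectrum D ?C"
        using simple_pole_P[OF lin' data', of x\<^sub>0] w(1) by (intro eigenvalue_in_spectrum) auto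
      have rho_C: "z \<in> resolvent_set D ?C" if "z \<in> ball (complex_of_real \<mu>\<^sub>0) r" "z \<noteq> \<nu>" for z
        by (rule near(1)[OF that(2) small[OF that(1)]])
      have unique: "spectrum D ?C \<inter> ball (complex_of_real \<mu>\<^sub>0) r = {\<nu>}"
        using \<nu>_ball \<nu>_spec rho_C unfolding spectrum_def by blast
      have conj: "x \<in> D \<Longrightarrow> conjugation x \<in> D" "x \<in> D \<Longrightarrow> ?C (conjugation x) = conjugation (?C x)" for x
        using real_operator_conjugation[OF lin real] positive_operator_conjugation[OF B_pos B_hom]
        by (simp_all add: conjugation_ops)
      have "cnj \<nu> \<in> spectrum D ?C"
        using resolvent_set_cnj[of D ?C "cnj \<nu>", OF conj] \<nu>_spec by (auto simp: spectrum_def)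
      moreover have "cnj \<nu> \<in> ball (complex_of_real \<mu>\<^sub>0) r"
        using \<nu>_ball complex_mod_cnj[of "complex_of_real \<mu>\<^sub>0 - \<nu>"] by (simp add: dist_norm)
      ultimately have cnj: "cnj \<nu> = \<nu>" using unique by blast
      define \<nu>' where "\<nu>' = Re \<nu>"
      have \<nu>': "\<nu> = complex_of_real \<nu>'"
        using cnj by (simp add: \<nu>'_def complex_eq_iff)
      have \<nu>'_near: "\<bar>\<nu>' - \<mu>\<^sub>0\<bar> < r / 4"
        using \<nu>_near unfolding \<nu>' by (simp flip: of_real_diff)
      have P'_nz: "P' \<noteq> 0" using \<open>P' x\<^sub>0 = w\<close> w(1) by auto
      have pole: "pole_of_resolvent D ?C \<nu>" by (rule pole_of_resolvent_simple[OF lin' data' P'_nz])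
      have simple: "algebraically_simple_eigenvalue D ?C \<nu>"
        unfolding algebraically_simple_eigenvalue_def
        using pole spectral_projection_simple[OF lin' data'] w by blast
      have ball: "complex_of_real z \<in> ball (complex_of_real \<mu>\<^sub>0) r" "complex_of_real z \<noteq> \<nu>"
        if "\<nu>' < z" "z \<le> \<beta>" for z
      proof -
        have "\<bar>\<mu>\<^sub>0 - z\<bar> < r" using that \<nu>'_near r(1) unfolding \<beta>_def abs_less_iff by linarith
        then show "complex_of_real z \<in> ball (complex_of_real \<mu>\<^sub>0) r"
          by (simp add: dist_norm flip: of_real_diff)
        show "complex_of_real z \<noteq> \<nu>" using that(1) unfolding \<nu>' by simp
      qed
      have \<nu>'\<beta>: "\<nu>' < \<beta>" using \<nu>'_near r(1) unfolding \<beta>_def abs_less_iff by linarith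
      have R_pos: "positive_operator ?R"
        unfolding positive_operator_def
      proof (intro allI impI)
        fix f :: "'a complexification" assume "0 \<le> f"
        show "0 \<le> ?R f"
        proof (cases "f = 0")
          case False
          then have "0 < f" using \<open>0 \<le> f\<close> by (simp add: less_complexification_def)
          then obtain e where "e > 0" "e *\<^sub>R u \<le> ?R f"
            using strong_A[OF \<beta>] by (auto simp: strongly_positive_def)
          then show ?thesis using u0 by (meson order_trans scaleR_nonneg_nonneg less_imp_le)
        qed simp
      qed
      have "norm B * norm ?R < 1"
      proof -
        have "norm B * norm ?R \<le> norm B * (norm ?R + 1)" by (intro mult_left_mono) simp_all
        also have "\<dots> < 1"
          using B_norm norm_ge_zero[of ?R] by (simp add: \<epsilon>_def less_divide_eq add_nonneg_pos)
        finally show ?thesis .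
      qed
      note step = resolvent_positive_perturbation[OF rho_A[OF \<beta>] R_pos B_pos this]
      have RB_pos: "positive_operator (resolvent D ?C (complex_of_real \<beta>))"
        unfolding positive_operator_def
        using step(2) positive_operatorD[OF R_pos] by (meson order_trans)
      have strong: "strongly_positive u (resolvent D ?C (complex_of_real z) f)"
        if z: "\<nu>' < z" "z \<le> \<beta>" and f: "0 < f" for z f
      proof -
        have f0: "0 \<le> f" using f by simp
        let ?M = "norm P' / (z - \<nu>') + norm S' / (1 - (\<beta> - \<nu>') * norm S')"
        have "resolvent D ?C (complex_of_real \<beta>) f \<le> resolvent D ?C (complex_of_real z) f"
        proof (rule positive_resolvent_antimono[where \<alpha> = z and M = ?M])
          fix y assume y: "z \<le> y" "y \<le> \<beta>"
          then have y': "\<nu>' < y" using z by simp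
          show "complex_of_real y \<in> resolvent_set D ?C" by (intro rho_C ball y' y)
          have dist: "cmod (complex_of_real y - \<nu>) = y - \<nu>'"
            unfolding \<nu>' using y' by (simp flip: of_real_diff)
          have "(\<beta> - \<nu>') * norm S' < 1"
            using small[OF ball(1)[OF \<nu>'\<beta> order_refl]] \<nu>'\<beta> unfolding \<nu>' by (simp flip: of_real_diff)
          moreover have "(y - \<nu>') * norm S' \<le> (\<beta> - \<nu>') * norm S'"
            using y by (intro mult_right_mono) auto
          ultimately have "norm P' / (y - \<nu>') + norm S' / (1 - (y - \<nu>') * norm S') \<le> ?M"
            using y z y' by (intro add_mono divide_left_mono mult_pos_pos) auto
          then show "norm (resolvent D ?C (complex_of_real y)) \<le> ?M"
            using near(3)[OF ball(2)[OF y' y(2)] small[OF ball(1)[OF y' y(2)]]]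
            unfolding dist by simp
        qed (use RB_pos z f0 in auto)
        then have "?R f \<le> resolvent D ?C (complex_of_real z) f" using step(2)[OF f0] by (rule order_trans[rotated])
        then show ?thesis
          using strong_A[OF \<beta> f] unfolding strongly_positive_def by (meson order_trans)
      qed
      have "complex_of_real z \<in> resolvent_set D ?C \<and>
          (\<forall>f>0. strongly_positive u (resolvent D ?C (complex_of_real z) f))"
        if "z \<in> {\<nu>'<..\<beta>}" for z
        using that rho_C[OF ball, of z] strong[of z] by simp
      moreover have "complex_of_real \<nu>' \<in> spectrum D ?C" using \<nu>_spec unfolding \<nu>' .
      ultimately have "resolvent_unif_ev_strongly_positive D ?C u (Re \<nu>)"
        unfolding resolvent_unif_ev_strongly_positive_def \<nu>'_def[symmetric] using \<nu>'\<beta> by blast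
      moreover have "\<nu> \<in> \<real>" unfolding \<nu>' by (rule Reals_of_real)
      ultimately show ?thesis using unique pole simple by blast
    qed
    ultimately show ?thesis by blast
  qed
  ultimately show ?thesis by blast
qed

end
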